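(* Let $K$ and $L$ be compact lines, let $\phi:K\to L$ be a continuous increasing surjection, let $I$ be a set and let $T:C(L)\to c_0(I)$ be a bounded linear operator. If there exists a bounded linear operator $S:C(K)\to c_0(I)$ with $S\circ\phi^*=T$, then there exists a bounded linear operator $S':C(K)\to c_0(I)$ with $S'\circ\phi^*=T$ and $\Vert S'\Vert\le2\Vert T\Vert$.
   Context: A compact line is a totally ordered set which is compact in its order topology. $C(K)$ denotes the Banach space of real continuous functions on $K$ with the sup norm. $c_0(I)$ is the Banach space (sup norm) of real families $(a_i)_{i\in I}$ such that $\{i:|a_i|\ge\varepsilon\}$ is finite for every $\varepsilon>0$. The composition operator $\phi^*:C(L)\to C(K)$ is $\phi^*(f)=f\circ\phi$. *)

theory Defs
  imports "HOL-Analysis.Analysis"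
begin

text \<open>C(K) for a compact space K is modelled by the library type of (bounded) continuous
  real functions \<open>'k \<Rightarrow>\<^sub>C real\<close> with the sup norm.  A compact line is a type of class
  \<open>linorder_topology\<close> (order topology) with \<open>compact UNIV\<close>.\<close>

definition c0 :: "('i \<Rightarrow> real) set" where
  "c0 = {a. \<forall>\<epsilon>>0. finite {i. \<epsilon> \<le> \<bar>a i\<bar>}}"

definition supnorm :: "('i \<Rightarrow> real) \<Rightarrow> real" where
  "supnorm a = (SUP i. \<bar>a i\<bar>)"

definition bdd_lin_c0 :: "('a::real_normed_vector \<Rightarrow> ('i \<Rightarrow> real)) \<Rightarrow> bool" where
  "bdd_lin_c0 T \<longleftrightarrow>
     (\<forall>f g i. T (f + g) i = T f i + T g i) \<and>
     (\<forall>c f i. T (c *\<^sub>R f) i = c * T f i) \<and>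
     (\<forall>f. T f \<in> c0) \<and>
     (\<exists>M. \<forall>f. supnorm (T f) \<le> M * norm f)"

definition opnorm_c0 :: "('a::real_normed_vector \<Rightarrow> ('i \<Rightarrow> real)) \<Rightarrow> real" where
  "opnorm_c0 T = Sup {supnorm (T f) | f. norm f \<le> 1}"

definition comp_op :: "('k \<Rightarrow> 'l) \<Rightarrow> ('l::topological_space \<Rightarrow>\<^sub>C real) \<Rightarrow> ('k::topological_space \<Rightarrow>\<^sub>C real)" where
  "comp_op \<phi> g = Bcontfun (apply_bcontfun g \<circ> \<phi>)"

end

theory Submission
  imports Defs
begin

text \<open>Only the nondegenerate fibres \<open>[lo t, hi t]\<close> matter. For each of them fix \<open>cut t \<in> C(K)\<close> equal
  to 0 up to \<open>lo t\<close> and to 1 from \<open>hi t\<close> on; \<open>\<phi>\<^sup>*C(L)\<close> and the cuts span a dense subspace of the range of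
  a norm-one projection of \<open>C(K)\<close>, which interpolates between the endpoints of each fibre. Extend the
  coordinates of \<open>T\<close> to functionals \<open>R i\<close> on \<open>C(K)\<close> by Hahn--Banach with norm at most \<open>\<parallel>T\<parallel>\<close>; the task
  is to add multiples \<open>d i t\<close> of the jumps \<open>h \<mapsto> h (hi t) - h (lo t)\<close> such that \<open>R i (cut t) + d i t\<close>
  is null in \<open>i\<close> for each \<open>t\<close> and \<open>2 (\<Sum>t. \<bar>d i t\<bar>) \<le> \<parallel>T\<parallel>\<close>.

  The numbers \<open>R i (cut t)\<close> trace, as \<open>t\<close> runs along the line, a function of variation at most \<open>\<parallel>T\<parallel>\<close>.
  Two points \<open>s, t\<close> are tied to the extent \<open>sep (R i) s t\<close> to which this function stays away from 0 between
  them; this ultrametric quantity is null in \<open>i\<close>. If the points were enumerated and \<open>d i t\<close> were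
  \<open>- R i (cut t)\<close> shrunk towards 0 by the largest tie to an earlier point, then the \<open>\<bar>d i t\<bar>\<close> would be the
  lengths of the branches of the tree of excursions of the function, whose total is at most half its variation. The
  jumps may be uncountable, but because \<open>S\<close> exists, only countably many are relevant for each \<open>i\<close>, and
  the graph of ties between relevant points has countable components, which are enumerated separately.\<close>

subsection \<open>The Hahn--Banach theorem\<close>

text \<open>The triangle inequality puts every lower bound on the value at \<open>z\<close> below
  every upper bound, and \<open>c\<close> is the supremum of the lower ones. Scaling reduces a
  general \<open>k\<close> to the coefficients 1 and -1.\<close>

lemma Hahn_Banach_extension_constant:
  fixes G :: "('a::real_normed_vector \<times> real) set"
  assumes G: "subspace G" and dom: "\<And>x r. (x, r) \<in> G \<Longrightarrow> r \<le> N * norm x"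
    and N: "0 \<le> N"
  obtains c where "\<And>x r k. (x, r) \<in> G \<Longrightarrow> r + k * c \<le> N * norm (x + k *\<^sub>R z)"
proof -
  define L where "L = {r - N * norm (x - z) | x r. (x, r) \<in> G}"
  define c where "c = Sup L"
  have cross: "r - N * norm (x - z) \<le> N * norm (y + z) - s" if "(x, r) \<in> G" "(y, s) \<in> G" for x y r s
  proof -
    have "(x + y, r + s) \<in> G"
      using subspace_add[OF G that] by simp
    then have "r + s \<le> N * norm (x + y)"
      by (rule dom)
    also have "\<dots> \<le> N * (norm (x - z) + norm (y + z))"
      using norm_triangle_ineq[of "x - z" "y + z"] N by (intro mult_left_mono) auto
    finally show ?thesis
      by (simp add: algebra_simps)
  qed
  have zero: "(0, 0) \<in> G"
    using subspace_0[OF G] by (simp add: zero_prod_def)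
  then have "L \<noteq> {}"
    by (auto simp: L_def)
  have up: "bdd_above L"
    using cross[OF _ zero] by (auto simp: L_def intro!: bdd_aboveI)
  have lower: "r - N * norm (x - z) \<le> c" if "(x, r) \<in> G" for x r
    unfolding c_def using that up by (intro cSup_upper) (auto simp: L_def)
  have upper: "c \<le> N * norm (y + z) - s" if "(y, s) \<in> G" for y s
    unfolding c_def using cross[OF _ that] \<open>L \<noteq> {}\<close> by (intro cSup_least) (auto simp: L_def)
  have "r + k * c \<le> N * norm (x + k *\<^sub>R z)" if xr: "(x, r) \<in> G" for x r k
  proof (cases k "0 :: real" rule: linorder_cases)
    case equal
    then show ?thesis using dom[OF xr] by simp
  next
    case greater
    have "((1 / k) *\<^sub>R x, (1 / k) *\<^sub>R r) \<in> G"
      using subspace_scale[OF G xr, of "1 / k"] by simp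
    from upper[OF this] have "k * c \<le> k * (N * norm ((1 / k) *\<^sub>R x + z) - r / k)"
      using greater by (intro mult_left_mono) auto
    also have "\<dots> = N * norm (k *\<^sub>R ((1 / k) *\<^sub>R x + z)) - r"
      using greater by (simp only: norm_scaleR) (simp add: field_simps)
    also have "k *\<^sub>R ((1 / k) *\<^sub>R x + z) = x + k *\<^sub>R z"
      using greater by (simp add: scaleR_add_right)
    finally show ?thesis by simp
  next
    case less
    have "((1 / (- k)) *\<^sub>R x, (1 / (- k)) *\<^sub>R r) \<in> G"
      using subspace_scale[OF G xr, of "1 / (- k)"] by simp
    from lower[OF this] have "(- k) * ((1 / (- k)) * r - N * norm ((1 / (- k)) *\<^sub>R x - z)) \<le> (- k) * c"
      using less by (intro mult_left_mono) auto
    also have "(- k) * ((1 / (- k)) * r - N * norm ((1 / (- k)) *\<^sub>R x - z))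
        = r - N * norm ((- k) *\<^sub>R ((1 / (- k)) *\<^sub>R x - z))"
      using less by (simp only: norm_scaleR) (simp add: field_simps)
    also have "(- k) *\<^sub>R ((1 / (- k)) *\<^sub>R x - z) = x + k *\<^sub>R z"
      using less by (simp add: scaleR_diff_right)
    finally show ?thesis by simp
  qed
  then show thesis by (rule that)
qed

text \<open>Zorn's lemma is applied to dominated linear graphs containing that of \<open>f\<close>
  along \<open>j\<close>. Since \<open>f x\<close> is controlled by \<open>norm (j x)\<close>, a
  functional on the domain of \<open>j\<close> is the same as one on its range.\<close>

lemma Hahn_Banach_norm:
  fixes f :: "'b::real_vector \<Rightarrow> real" and j :: "'b \<Rightarrow> 'a::real_normed_vector"
  assumes f: "linear f" and j: "linear j" and N: "0 \<le> N"
    and bd: "\<And>x. \<bar>f x\<bar> \<le> N * norm (j x)"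
  obtains F where "linear F" "\<And>x. \<bar>F x\<bar> \<le> N * norm x" "\<And>x. F (j x) = f x"
proof -
  define G0 where "G0 = range (\<lambda>x. (j x, f x))"
  \<comment> \<open>One-sided domination carries everything: at \<open>- x\<close> it gives the
    lower bound, and at \<open>(0, r - s)\<close> it makes the graph single-valued.\<close>
  define \<G> where "\<G> = {G. subspace G \<and> G0 \<subseteq> G \<and> (\<forall>(x, r) \<in> G. r \<le> N * norm x)}"
  interpret f: linear f by fact
  interpret j: linear j by fact
  have "linear (\<lambda>x. (j x, f x))"
    by (intro linearI) (auto simp: f.add j.add f.scale j.scale)
  then have "subspace G0"
    unfolding G0_def by (intro linear_subspace_image) auto
  then have G0: "G0 \<in> \<G>"
    using bd by (auto simp: \<G>_def G0_def abs_le_iff)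
  have "\<exists>M\<in>\<G>. \<forall>X\<in>\<G>. M \<subseteq> X \<longrightarrow> X = M"
  proof (rule subset_Zorn_nonempty)
    fix \<C> assume ne: "\<C> \<noteq> {}" and ch: "subset.chain \<G> \<C>"
    then have sub: "\<C> \<subseteq> \<G>" and tot: "\<And>A B. A \<in> \<C> \<Longrightarrow> B \<in> \<C> \<Longrightarrow> A \<subseteq> B \<or> B \<subseteq> A"
      by (auto simp: subset_chain_def)
    have sp: "subspace A" if "A \<in> \<C>" for A
      using that sub by (auto simp: \<G>_def)
    have "subspace (\<Union>\<C>)"
      unfolding subspace_def
    proof (intro conjI ballI allI)
      show "0 \<in> \<Union>\<C>" using ne sp subspace_0 by blast
    next
      fix x y assume "x \<in> \<Union>\<C>" "y \<in> \<Union>\<C>"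
      then obtain A where "A \<in> \<C>" "x \<in> A" "y \<in> A" using tot by blast
      then show "x + y \<in> \<Union>\<C>" using sp subspace_add by blast
    next
      fix c x assume "x \<in> \<Union>\<C>"
      then show "c *\<^sub>R x \<in> \<Union>\<C>" using sp subspace_scale by blast
    qed
    then show "\<Union>\<C> \<in> \<G>"
      using ne sub by (auto simp: \<G>_def)
  qed (use G0 in auto)
  then obtain G where GG: "G \<in> \<G>" and max: "\<And>X. X \<in> \<G> \<Longrightarrow> G \<subseteq> X \<Longrightarrow> X = G"
    by blast
  then have G: "subspace G" and "G0 \<subseteq> G" and dom: "\<And>x r. (x, r) \<in> G \<Longrightarrow> r \<le> N * norm x"
    by (auto simp: \<G>_def)
  have total: "\<exists>r. (z, r) \<in> G" for z
  proof -
    obtain c where c: "\<And>x r k. (x, r) \<in> G \<Longrightarrow> r + k * c \<le> N * norm (x + k *\<^sub>R z)"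
      using Hahn_Banach_extension_constant[OF G dom N] by metis
    let ?H = "span (insert (z, c) G)"
    have "r \<le> N * norm x" if H: "(x, r) \<in> ?H" for x r
    proof -
      obtain k where "(x, r) - k *\<^sub>R (z, c) \<in> span G"
        using H by (auto simp: span_breakdown_eq)
      then have "(x - k *\<^sub>R z, r - k * c) \<in> G"
        using G by (simp add: span_eq_iff[THEN iffD2])
      from c[OF this, of k] show ?thesis by simp
    qed
    moreover have "G \<subseteq> ?H"
      using span_superset by blast
    ultimately have "?H \<in> \<G>"
      using \<open>G0 \<subseteq> G\<close> by (auto simp: \<G>_def)
    then have "?H = G"
      using max \<open>G \<subseteq> ?H\<close> by blast
    then show ?thesis
      by (metis insertI1 span_base)
  qed
  have unique: "r = s" if "(x, r) \<in> G" "(x, s) \<in> G" for x r s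
    using subspace_diff[OF G that] subspace_diff[OF G that(2,1)] dom[of 0 "r - s"] dom[of 0 "s - r"]
    by simp
  define F where "F x = (THE r. (x, r) \<in> G)" for x
  have F: "(x, F x) \<in> G" for x
    unfolding F_def using total unique by (metis theI)
  have F_eq: "F x = r" if "(x, r) \<in> G" for x r
    using F unique that by blast
  show thesis
  proof
    show lin: "linear F"
    proof
      show "F (x + y) = F x + F y" for x y
        using subspace_add[OF G F F, of x y] by (intro F_eq) simp
      show "F (c *\<^sub>R x) = c *\<^sub>R F x" for c x
        using subspace_scale[OF G F, of c x] by (intro F_eq) simp
    qed
    show "\<bar>F x\<bar> \<le> N * norm x" for x
      using dom[OF F, of x] dom[OF F, of "- x"] by (simp add: linear_neg[OF lin] abs_le_iff)
    show "F (j x) = f x" for x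
      using \<open>G0 \<subseteq> G\<close> by (intro F_eq) (auto simp: G0_def)
  qed
qed

subsection \<open>Operators into \<open>c\<^sub>0\<close>\<close>

lemma c0D: "a \<in> c0 \<Longrightarrow> 0 < e \<Longrightarrow> finite {i. e \<le> \<bar>a i\<bar>}"
  by (simp add: c0_def)

lemma c0I: "(\<And>e. 0 < e \<Longrightarrow> finite {i. e \<le> \<bar>a i\<bar>}) \<Longrightarrow> a \<in> c0"
  by (simp add: c0_def)

lemma c0_add:
  assumes a: "a \<in> c0" and b: "b \<in> c0"
  shows "(\<lambda>i. a i + b i) \<in> c0"
proof (rule c0I)
  fix e :: real assume e: "0 < e"
  have "{i. e \<le> \<bar>a i + b i\<bar>} \<subseteq> {i. e / 2 \<le> \<bar>a i\<bar>} \<union> {i. e / 2 \<le> \<bar>b i\<bar>}"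
    by auto
  then show "finite {i. e \<le> \<bar>a i + b i\<bar>}"
    by (rule finite_subset) (use c0D[OF a, of "e / 2"] c0D[OF b, of "e / 2"] e in simp)
qed

text \<open>The error is absorbed by halving the threshold. This covers both domination and uniform
  limits.\<close>

lemma c0_approx:
  assumes "\<And>e. 0 < e \<Longrightarrow> \<exists>b\<in>c0. \<forall>i. \<bar>a i\<bar> \<le> \<bar>b i\<bar> + e"
  shows "a \<in> c0"
proof (rule c0I)
  fix e :: real assume e: "0 < e"
  then obtain b where b: "b \<in> c0" "\<And>i. \<bar>a i\<bar> \<le> \<bar>b i\<bar> + e / 2"
    using assms[of "e / 2"] by auto
  have "{i. e \<le> \<bar>a i\<bar>} \<subseteq> {i. e / 2 \<le> \<bar>b i\<bar>}"
  proof clarify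
    fix i assume "e \<le> \<bar>a i\<bar>"
    then show "e / 2 \<le> \<bar>b i\<bar>" using b(2)[of i] by linarith
  qed
  then show "finite {i. e \<le> \<bar>a i\<bar>}"
    by (rule finite_subset) (use c0D[OF b(1), of "e / 2"] e in simp)
qed

lemma c0_mono: "b \<in> c0 \<Longrightarrow> (\<And>i. \<bar>a i\<bar> \<le> \<bar>b i\<bar>) \<Longrightarrow> a \<in> c0"
  by (rule c0_approx, rule bexI[of _ b]) (auto simp: add_increasing2)

lemma c0_zero: "(\<lambda>i. 0) \<in> c0"
  by (simp add: c0_def)

lemma c0_cmult:
  assumes "a \<in> c0"
  shows "(\<lambda>i. c * a i) \<in> c0"
proof (rule c0I)
  fix e :: real assume e: "0 < e"
  have "{i. e \<le> \<bar>c * a i\<bar>} \<subseteq> {i. e / (\<bar>c\<bar> + 1) \<le> \<bar>a i\<bar>}"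
  proof clarify
    fix i assume "e \<le> \<bar>c * a i\<bar>"
    also have "\<dots> \<le> (\<bar>c\<bar> + 1) * \<bar>a i\<bar>"
      by (simp add: abs_mult algebra_simps)
    finally show "e / (\<bar>c\<bar> + 1) \<le> \<bar>a i\<bar>"
      by (simp add: divide_le_eq mult.commute)
  qed
  then show "finite {i. e \<le> \<bar>c * a i\<bar>}"
    by (rule finite_subset) (use c0D[OF assms, of "e / (\<bar>c\<bar> + 1)"] e in simp)
qed

lemma c0_sum: "(\<And>x. x \<in> F \<Longrightarrow> a x \<in> c0) \<Longrightarrow> (\<lambda>i. \<Sum>x\<in>F. a x i) \<in> c0"
  by (induction F rule: infinite_finite_induct) (auto intro: c0_zero c0_add)

lemma c0_abs: "a \<in> c0 \<Longrightarrow> (\<lambda>i. \<bar>a i\<bar>) \<in> c0"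
  by (simp add: c0_def)

lemma c0_bounded:
  assumes "a \<in> c0"
  shows "bdd_above (range (\<lambda>i. \<bar>a i\<bar>))"
proof -
  have fin: "finite {i. 1 \<le> \<bar>a i\<bar>}"
    using assms by (auto simp: c0_def)
  have "range (\<lambda>i. \<bar>a i\<bar>) \<subseteq> (\<lambda>i. \<bar>a i\<bar>) ` {i. 1 \<le> \<bar>a i\<bar>} \<union> {..1}"
    by auto
  moreover have "bdd_above ((\<lambda>i. \<bar>a i\<bar>) ` {i. 1 \<le> \<bar>a i\<bar>} \<union> {..1})"
    using fin by (simp only: bdd_above_Un bdd_above_finite finite_imageI bdd_above_Iic simp_thms)
  ultimately show ?thesis
    by (rule bdd_above_mono[rotated])
qed

lemma abs_le_supnorm: "a \<in> c0 \<Longrightarrow> \<bar>a i\<bar> \<le> supnorm a"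
  unfolding supnorm_def by (intro cSUP_upper c0_bounded) auto

lemma supnorm_le: "(\<And>i. \<bar>a i\<bar> \<le> B) \<Longrightarrow> supnorm a \<le> B"
  unfolding supnorm_def by (intro cSUP_least) auto

lemma bdd_lin_c0_linear: "bdd_lin_c0 T \<Longrightarrow> linear (\<lambda>f. T f i)"
  by (intro linearI) (auto simp: bdd_lin_c0_def)

lemma bdd_lin_c0_uniform_bound:
  assumes "bdd_lin_c0 T"
  obtains M where "0 \<le> M" "\<And>f i. \<bar>T f i\<bar> \<le> M * norm f"
proof -
  obtain M where M: "\<And>f. supnorm (T f) \<le> M * norm f" and c0: "\<And>f. T f \<in> c0"
    using assms by (auto simp: bdd_lin_c0_def)
  have "\<bar>T f i\<bar> \<le> \<bar>M\<bar> * norm f" for f i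
  proof -
    have "\<bar>T f i\<bar> \<le> supnorm (T f)"
      by (rule abs_le_supnorm[OF c0])
    also have "\<dots> \<le> M * norm f"
      by (rule M)
    also have "\<dots> \<le> \<bar>M\<bar> * norm f"
      by (intro mult_right_mono) auto
    finally show ?thesis .
  qed
  then show thesis
    by (intro that[of "\<bar>M\<bar>"]) auto
qed

lemma opnorm_c0_bdd_above:
  assumes "bdd_lin_c0 T"
  shows "bdd_above {supnorm (T f) | f. norm f \<le> 1}"
proof -
  obtain M where M: "0 \<le> M" "\<And>f i. \<bar>T f i\<bar> \<le> M * norm f"
    using bdd_lin_c0_uniform_bound[OF assms] by metis
  have "supnorm (T f) \<le> M" if "norm f \<le> 1" for f
    using M(2)[of f] mult_left_mono[OF that M(1)] by (intro supnorm_le) (simp, meson order_trans)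
  then show ?thesis
    by (auto intro!: bdd_aboveI[where M = M])
qed

lemma opnorm_c0_bound:
  assumes T: "bdd_lin_c0 T"
  shows "\<bar>T f i\<bar> \<le> opnorm_c0 T * norm f"
proof (cases "f = 0")
  case True
  then show ?thesis
    using linear_0[OF bdd_lin_c0_linear[OF T]] by simp
next
  case False
  define g where "g = (1 / norm f) *\<^sub>R f"
  have "\<bar>T g i\<bar> \<le> supnorm (T g)"
    using T by (intro abs_le_supnorm) (auto simp: bdd_lin_c0_def)
  also have "\<dots> \<le> opnorm_c0 T"
    unfolding opnorm_c0_def using False
    by (intro cSup_upper opnorm_c0_bdd_above[OF T]) (auto simp: g_def)
  finally have "\<bar>T g i\<bar> * norm f \<le> opnorm_c0 T * norm f"
    by (intro mult_right_mono) auto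
  moreover have "T g i * norm f = T f i"
    using False T by (simp add: g_def bdd_lin_c0_def)
  ultimately show ?thesis
    by (metis abs_mult abs_norm_cancel)
qed

lemma opnorm_c0_nonneg:
  assumes "bdd_lin_c0 T"
  shows "0 \<le> opnorm_c0 T"
proof -
  have "supnorm (T 0) = 0"
    using linear_0[OF bdd_lin_c0_linear[OF assms]] by (simp add: supnorm_def)
  then show ?thesis
    unfolding opnorm_c0_def
    by (intro cSup_upper opnorm_c0_bdd_above[OF assms]) (auto intro!: exI[of _ 0])
qed

lemma bdd_lin_c0I:
  assumes "\<And>i. linear (\<lambda>f. T f i)" and "\<And>f. T f \<in> c0" and "\<And>f i. \<bar>T f i\<bar> \<le> M * norm f"
  shows "bdd_lin_c0 T"
proof -
  have "supnorm (T f) \<le> M * norm f" for f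
    using assms(3) by (rule supnorm_le)
  then show ?thesis
    unfolding bdd_lin_c0_def
    using assms(2) linear_add[OF assms(1)] linear_scale[OF assms(1)] by auto
qed

lemma opnorm_c0_le:
  assumes "\<And>f i. \<bar>T f i\<bar> \<le> M * norm f" and "0 \<le> M"
  shows "opnorm_c0 T \<le> M"
  unfolding opnorm_c0_def
proof (rule cSup_least)
  show "{supnorm (T f) | f. norm f \<le> 1} \<noteq> {}"
    by (auto intro: exI[of _ 0])
  fix r assume "r \<in> {supnorm (T f) | f. norm f \<le> 1}"
  then obtain f where f: "norm f \<le> 1" "r = supnorm (T f)" by auto
  have "\<bar>T f i\<bar> \<le> M" for i
    using assms(1)[of f i] mult_left_mono[OF f(1) assms(2)] by simp
  then show "r \<le> M"
    using f(2) supnorm_le by blast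
qed

subsection \<open>Ultrametric ties along a line\<close>

text \<open>If \<open>m\<close> gives the heights at which neighbouring branches of a tree separate,
  the sum of the branch heights minus \<open>steps m\<close> is the total length of the
  tree.\<close>

fun steps :: "('q \<Rightarrow> 'q \<Rightarrow> real) \<Rightarrow> 'q list \<Rightarrow> real" where
  "steps m (x # y # zs) = m x y + steps m (y # zs)"
| "steps m _ = 0"

text \<open>Of the ties from \<open>z\<close> to its two neighbours, the smaller is at most the tie
  it replaces and the larger is at most \<open>M\<close>.\<close>

lemma steps_insert_le:
  assumes "\<And>x. x \<in> set xs \<Longrightarrow> m x z \<le> M" "\<And>y. y \<in> set ys \<Longrightarrow> m z y \<le> M" "0 \<le> M"
    and "\<And>x y. x \<in> set xs \<Longrightarrow> y \<in> set ys \<Longrightarrow> min (m x z) (m z y) \<le> m x y"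
  shows "steps m (xs @ z # ys) \<le> steps m (xs @ ys) + M"
  using assms
proof (induction xs rule: induct_list012)
  case 1
  then show ?case by (cases ys) auto
next
  case (2 x)
  show ?case
  proof (cases ys)
    case Nil
    then show ?thesis using 2 by simp
  next
    case (Cons y ys')
    then have "m x z \<le> M" "m z y \<le> M" "min (m x z) (m z y) \<le> m x y"
      using 2 by auto
    then show ?thesis
      using Cons by (auto simp: min_def split: if_splits)
  qed
next
  case (3 x x' xs)
  then have "steps m ((x' # xs) @ z # ys) \<le> steps m ((x' # xs) @ ys) + M"
    by (intro "3.IH") auto
  then show ?case by simp
qed

text \<open>The points are inserted in the order of \<open>e\<close>; by the ultrametric inequality each insertion
  costs at most the tie \<open>m\<close> to one of the points already present.\<close>

lemma steps_le_sum:
  fixes zs :: "'q::linorder list" and e :: "'q \<Rightarrow> nat"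
  assumes "sorted_wrt (<) zs"
    and "\<And>x y z. x \<in> set zs \<Longrightarrow> z \<in> set zs \<Longrightarrow> y \<in> set zs \<Longrightarrow> x < z \<Longrightarrow> z < y
          \<Longrightarrow> min (m x z) (m z y) \<le> m x y"
    and "\<And>z. z \<in> set zs \<Longrightarrow> 0 \<le> M z"
    and "\<And>x y. x \<in> set zs \<Longrightarrow> y \<in> set zs \<Longrightarrow> x < y \<Longrightarrow> e x \<le> e y \<Longrightarrow> m x y \<le> M y"
    and "\<And>x y. x \<in> set zs \<Longrightarrow> y \<in> set zs \<Longrightarrow> x < y \<Longrightarrow> e y \<le> e x \<Longrightarrow> m x y \<le> M x"
  shows "steps m zs \<le> sum M (set zs)"
  using assms
proof (induction "length zs" arbitrary: zs)
  case 0
  then show ?case by simp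
next
  case (Suc n)
  have "Max (e ` set zs) \<in> e ` set zs"
    using Suc.hyps(2) by (intro Max_in) auto
  then obtain z where z: "z \<in> set zs" and "e z = Max (e ` set zs)"
    by auto
  then have zmax: "\<And>x. x \<in> set zs \<Longrightarrow> e x \<le> e z"
    by simp
  obtain xs ys where zs: "zs = xs @ z # ys"
    using z by (meson split_list)
  have srt: "\<And>x. x \<in> set xs \<Longrightarrow> x < z" "\<And>y. y \<in> set ys \<Longrightarrow> z < y"
    "\<And>x y. x \<in> set xs \<Longrightarrow> y \<in> set ys \<Longrightarrow> x < y"
    using Suc.prems(1) by (auto simp: zs sorted_wrt_append)
  have "steps m zs \<le> steps m (xs @ ys) + M z"
    unfolding zs
  proof (rule steps_insert_le)
    show "m x z \<le> M z" if "x \<in> set xs" for x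
      using that srt zmax by (intro Suc.prems(4)) (auto simp: zs)
    show "m z y \<le> M z" if "y \<in> set ys" for y
      using that srt zmax by (intro Suc.prems(5)) (auto simp: zs)
    show "0 \<le> M z"
      using z by (rule Suc.prems(3))
    show "min (m x z) (m z y) \<le> m x y" if "x \<in> set xs" "y \<in> set ys" for x y
      using that srt by (intro Suc.prems(2)) (auto simp: zs)
  qed
  also have "steps m (xs @ ys) \<le> sum M (set (xs @ ys))"
    using Suc.hyps(2) Suc.prems by (intro Suc.hyps(1)) (auto simp: zs sorted_wrt_append)
  also have "sum M (set (xs @ ys)) + M z = sum M (set zs)"
    using srt by (subst add.commute, subst sum.insert[symmetric])
      (auto simp: zs intro!: arg_cong[where f = "sum M"])
  finally show ?case by simp
qed

text \<open>Two members of the chain of equal cardinality coincide, so \<open>card\<close> embeds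
  the chain into the naturals.\<close>

lemma countable_Union_chain_finite:
  assumes fin: "\<And>A. A \<in> \<A> \<Longrightarrow> finite A"
    and chain: "\<And>A B. A \<in> \<A> \<Longrightarrow> B \<in> \<A> \<Longrightarrow> A \<subseteq> B \<or> B \<subseteq> A"
  shows "countable (\<Union>\<A>)"
proof -
  have "inj_on card \<A>"
    by (rule inj_onI) (metis card_subset_eq chain fin)
  then have "countable \<A>"
    by (rule countableI')
  then have "countable (\<Union>A\<in>\<A>. A)"
    using fin by (intro countable_UN) (auto intro: countable_finite)
  then show ?thesis by simp
qed

text \<open>Each vertex of the graph joining two points of some \<open>A i\<close> at which \<open>m i\<close> is positive has
  countable degree: on one side of \<open>x\<close>, the sets \<open>{i. \<delta> \<le> m i x y}\<close> form a chain of finite sets.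
  So its components are countable, and each can be enumerated.\<close>

lemma exists_local_enumeration:
  fixes m :: "'i \<Rightarrow> 'q::linorder \<Rightarrow> 'q \<Rightarrow> real" and A :: "'i \<Rightarrow> 'q set"
  assumes A: "\<And>i. A i \<subseteq> Q" "\<And>i. countable (A i)"
    and m: "\<And>x y. x \<in> Q \<Longrightarrow> y \<in> Q \<Longrightarrow> x < y \<Longrightarrow> (\<lambda>i. m i x y) \<in> c0"
    and right: "\<And>i x y z. x \<in> Q \<Longrightarrow> y \<in> Q \<Longrightarrow> z \<in> Q \<Longrightarrow> x < y \<Longrightarrow> y \<le> z \<Longrightarrow> m i x z \<le> m i x y"
    and left: "\<And>i x y z. x \<in> Q \<Longrightarrow> y \<in> Q \<Longrightarrow> z \<in> Q \<Longrightarrow> x \<le> y \<Longrightarrow> y < z \<Longrightarrow> m i x z \<le> m i y z"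
  obtains e :: "'q \<Rightarrow> nat" and B :: "'q \<Rightarrow> 'q set"
  where "\<And>q. finite (B q)" "\<And>q. q \<in> Q \<Longrightarrow> B q \<subseteq> Q - {q}"
    "\<And>i x y. x \<in> A i \<Longrightarrow> y \<in> A i \<Longrightarrow> x < y \<Longrightarrow> 0 < m i x y \<Longrightarrow> e x \<le> e y \<Longrightarrow> x \<in> B y"
    "\<And>i x y. x \<in> A i \<Longrightarrow> y \<in> A i \<Longrightarrow> x < y \<Longrightarrow> 0 < m i x y \<Longrightarrow> e y \<le> e x \<Longrightarrow> y \<in> B x"
proof -
  define E where "E = {(x, y). \<exists>i. x \<in> A i \<and> y \<in> A i \<and> (x < y \<and> 0 < m i x y \<or> y < x \<and> 0 < m i y x)}"
  have fin: "finite {i. \<delta> \<le> m i x y}" if "x \<in> Q" "y \<in> Q" "x < y" "0 < \<delta>" for x y \<delta>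
  proof -
    have "{i. \<delta> \<le> m i x y} \<subseteq> {i. \<delta> \<le> \<bar>m i x y\<bar>}" by auto
    then show ?thesis
      using m[OF that(1-3)] that(4) by (auto simp: c0_def intro: finite_subset)
  qed
  \<comment> \<open>Positivity is split into countably many thresholds, each of which yields a chain
    of finite index sets.\<close>
  have pos: "0 < r \<longleftrightarrow> (\<exists>n. 1 / real (Suc n) \<le> r)" for r :: real
    by (metis inverse_eq_divide less_imp_le of_nat_0_less_iff reals_Archimedean zero_less_Suc
        zero_less_divide_1_iff less_le_trans)
  have deg: "countable (E `` {x})" if x: "x \<in> Q" for x
  proof -
    let ?J = "\<Union>n. \<Union>((\<lambda>y. {i. 1 / real (Suc n) \<le> m i x y}) ` {y \<in> Q. x < y})"
    let ?J' = "\<Union>n. \<Union>((\<lambda>y. {i. 1 / real (Suc n) \<le> m i y x}) ` {y \<in> Q. y < x})"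
    have J: "countable ?J"
    proof (rule countable_UN[OF countableI_type], rule countable_Union_chain_finite)
      fix n S T
      assume S: "S \<in> (\<lambda>y. {i. 1 / real (Suc n) \<le> m i x y}) ` {y \<in> Q. x < y}"
        and T: "T \<in> (\<lambda>y. {i. 1 / real (Suc n) \<le> m i x y}) ` {y \<in> Q. x < y}"
      show "finite S" using S fin[OF x] by auto
      obtain y z where y: "y \<in> Q" "x < y" "S = {i. 1 / real (Suc n) \<le> m i x y}"
        and z: "z \<in> Q" "x < z" "T = {i. 1 / real (Suc n) \<le> m i x z}"
        using S T by auto
      show "S \<subseteq> T \<or> T \<subseteq> S"
      proof (cases "y \<le> z")
        case True
        then show ?thesis
          using right[OF x y(1) z(1) y(2)] y(3) z(3) by (auto intro: order_trans)
      next
        case False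
        then show ?thesis
          using right[OF x z(1) y(1) z(2)] y(3) z(3) by (auto intro: order_trans)
      qed
    qed
    have J': "countable ?J'"
    proof (rule countable_UN[OF countableI_type], rule countable_Union_chain_finite)
      fix n S T
      assume S: "S \<in> (\<lambda>y. {i. 1 / real (Suc n) \<le> m i y x}) ` {y \<in> Q. y < x}"
        and T: "T \<in> (\<lambda>y. {i. 1 / real (Suc n) \<le> m i y x}) ` {y \<in> Q. y < x}"
      show "finite S" using S fin[OF _ x] by auto
      obtain y z where y: "y \<in> Q" "y < x" "S = {i. 1 / real (Suc n) \<le> m i y x}"
        and z: "z \<in> Q" "z < x" "T = {i. 1 / real (Suc n) \<le> m i z x}"
        using S T by auto
      show "S \<subseteq> T \<or> T \<subseteq> S"
      proof (cases "y \<le> z")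
        case True
        then show ?thesis
          using left[OF y(1) z(1) x _ z(2)] y(3) z(3) by (auto intro: order_trans)
      next
        case False
        then show ?thesis
          using left[OF z(1) y(1) x _ y(2)] y(3) z(3) by (auto intro: order_trans)
      qed
    qed
    \<comment> \<open>Only countably many indices \<open>i\<close> give \<open>x\<close> an edge,
      and a neighbour through \<open>i\<close> lies in the countable set \<open>A i\<close>.\<close>
    have "countable (\<Union>i\<in>?J \<union> ?J'. A i)"
      by (rule countable_UN[OF countable_Un[OF J J'] A(2)])
    moreover have "E `` {x} \<subseteq> (\<Union>i\<in>?J \<union> ?J'. A i)"
    proof
      fix y assume "y \<in> E `` {x}"
      then obtain i where i: "x \<in> A i" "y \<in> A i" "x < y \<and> 0 < m i x y \<or> y < x \<and> 0 < m i y x"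
        by (auto simp: E_def)
      then have "y \<in> Q" using A(1) by blast
      then have "i \<in> ?J \<union> ?J'"
        using i(3) unfolding pos by blast
      then show "y \<in> (\<Union>i\<in>?J \<union> ?J'. A i)"
        using i(2) by blast
    qed
    ultimately show ?thesis
      by (rule countable_subset[rotated])
  qed
  have EQ: "E \<subseteq> Q \<times> Q"
    using A(1) by (auto simp: E_def)
  have deg': "countable (E `` {x})" for x
  proof (cases "x \<in> Q")
    case False
    then have "E `` {x} = {}" using EQ by auto
    then show ?thesis by simp
  qed (rule deg)
  have "countable (E `` Y)" if "countable Y" for Y
  proof -
    have "E `` Y = (\<Union>y\<in>Y. E `` {y})" by auto
    then show ?thesis using that deg' by simp
  qed
  then have count: "countable (E\<^sup>* `` {x})" for x
    by (intro countable_rtrancl) auto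
  have "sym E"
    by (auto simp: sym_def E_def)
  then have symE: "sym (E\<^sup>*)"
    by (rule sym_rtrancl)
  \<comment> \<open>Each component has its own numbering. Numbers of different components may
    coincide, but only points joined by an edge are compared.\<close>
  define e where "e q = to_nat_on (E\<^sup>* `` {q}) q" for q
  have comp_eq: "E\<^sup>* `` {x} = E\<^sup>* `` {y}" if "(x, y) \<in> E\<^sup>*" for x y
    using that symE by (auto dest: symD intro: rtrancl_trans)
  have e_inj: "x = y" if "(x, y) \<in> E\<^sup>*" "e x = e y" for x y
  proof -
    have "to_nat_on (E\<^sup>* `` {x}) x = to_nat_on (E\<^sup>* `` {x}) y"
      using that(2) comp_eq[OF that(1)] by (simp add: e_def)
    then show ?thesis
      using that(1) by (subst (asm) to_nat_on_inj[OF count]) auto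
  qed
  \<comment> \<open>Only predecessors in the component of \<open>q\<close> count. There
    \<open>e\<close> is injective, so \<open>B q\<close> has at most \<open>e q\<close>
    elements.\<close>
  define B where "B q = {x. (q, x) \<in> E\<^sup>* \<and> e x < e q}" for q
  show thesis
  proof
    show "finite (B q)" for q
    proof (rule finite_imageD)
      show "finite (e ` B q)"
        by (rule finite_subset[of _ "{..< e q}"]) (auto simp: B_def)
      show "inj_on e (B q)"
        by (rule inj_onI) (metis (mono_tags, lifting) B_def e_inj mem_Collect_eq rtrancl_trans symD symE)
    qed
    show "B q \<subseteq> Q - {q}" if "q \<in> Q" for q
    proof
      fix x assume x: "x \<in> B q"
      then have "x \<noteq> q" by (auto simp: B_def)
      moreover have "(q, x) \<in> E\<^sup>*" using x by (simp add: B_def)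
      then have "x \<in> Q"
        using that EQ by (induction rule: rtrancl_induct) auto
      ultimately show "x \<in> Q - {q}" by blast
    qed
    fix i x y
    assume xy: "x \<in> A i" "y \<in> A i" "x < y" "0 < m i x y"
    then have E: "(x, y) \<in> E" "(y, x) \<in> E"
      by (auto simp: E_def)
    then have "e x \<noteq> e y"
      using e_inj[of x y] xy(3) by blast
    then show "e x \<le> e y \<Longrightarrow> x \<in> B y" "e y \<le> e x \<Longrightarrow> y \<in> B x"
      using E by (auto simp: B_def)
  qed
qed

subsection \<open>Functions on a compact line and on its image\<close>

lemma compact_line_separation:
  fixes a b :: "'a::linorder_topology"
  assumes cpt: "compact (UNIV :: 'a set)" and ab: "a < b"
  obtains u :: "'a \<Rightarrow>\<^sub>C real" where "\<And>x. 0 \<le> u x" "\<And>x. u x \<le> 1"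
    "\<And>x. x \<le> a \<Longrightarrow> u x = 0" "\<And>x. b \<le> x \<Longrightarrow> u x = 1"
proof -
  have "normal_space (euclidean :: 'a topology)"
  proof (rule compact_Hausdorff_or_regular_imp_normal_space)
    show "compact_space (euclidean :: 'a topology)"
      using cpt by (simp add: compact_space_def)
    have "Hausdorff_space (euclidean :: 'a topology)"
      unfolding Hausdorff_space_def disjnt_def by (simp, metis hausdorff)
    then show "Hausdorff_space (euclidean :: 'a topology) \<or> regular_space (euclidean :: 'a topology)" ..
  qed
  moreover have "closedin euclidean {..a}" "closedin euclidean {b..}" "disjnt {..a} {b..}"
    using ab by (auto simp: disjnt_def)
  ultimately obtain f :: "'a \<Rightarrow> real" where
    f: "continuous_map euclidean (subtopology euclideanreal {0..1}) f" "f ` {..a} \<subseteq> {0}" "f ` {b..} \<subseteq> {1}"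
    using Urysohn_lemma[of euclidean "{..a}" "{b..}" 0 1] by auto
  then have cont: "continuous_on UNIV f" and range: "\<And>x. 0 \<le> f x \<and> f x \<le> 1"
    by (auto simp: continuous_map_in_subtopology)
  then have "f \<in> bcontfun"
    by (intro bcontfun_normI[where b = 1]) auto
  then have "apply_bcontfun (Bcontfun f) = f"
    by (rule Bcontfun_inverse)
  with f(2,3) range show thesis
    by (intro that[of "Bcontfun f"]) auto
qed

lemma continuous_on_compact_bcontfun:
  fixes f :: "'a::topological_space \<Rightarrow> real"
  assumes "compact (UNIV :: 'a set)" "continuous_on UNIV f"
  shows "f \<in> bcontfun"
  using assms compact_continuous_image[OF assms(2,1)] by (auto simp: bcontfun_def compact_imp_bounded)

lemma apply_bcontfun_sum [simp]:
  "apply_bcontfun (\<Sum>t\<in>F. u t) x = (\<Sum>t\<in>F. apply_bcontfun (u t) x)"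
  by (induction F rule: infinite_finite_induct) auto

lemma abs_apply_le_norm: "\<bar>apply_bcontfun (h :: 'a::topological_space \<Rightarrow>\<^sub>C real) x\<bar> \<le> norm h"
  using norm_bounded[of h x] by simp

lemma norm_le_of_abs:
  fixes h :: "'a::topological_space \<Rightarrow>\<^sub>C real"
  shows "(\<And>x. \<bar>h x\<bar> \<le> b) \<Longrightarrow> norm h \<le> b"
  by (rule norm_bound) simp

section \<open>Fibres of the surjection, cuts and jumps\<close>

locale compact_line_surjection =
  fixes \<phi> :: "'k::linorder_topology \<Rightarrow> 'l::linorder_topology"
  assumes cpt_k: "compact (UNIV :: 'k set)" and cpt_l: "compact (UNIV :: 'l set)"
    and cont: "continuous_on UNIV \<phi>" and mono: "mono \<phi>" and surj: "surj \<phi>"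
begin

definition lo :: "'l \<Rightarrow> 'k" where
  "lo t = (SOME x. \<phi> x = t \<and> (\<forall>y. \<phi> y = t \<longrightarrow> x \<le> y))"

definition hi :: "'l \<Rightarrow> 'k" where
  "hi t = (SOME x. \<phi> x = t \<and> (\<forall>y. \<phi> y = t \<longrightarrow> y \<le> x))"

lemma compact_fibre: "compact (\<phi> -` {t})"
proof -
  have "closed (\<phi> -` {t})"
    using cont by (intro continuous_closed_vimage) (auto simp: continuous_on_eq_continuous_at)
  then show ?thesis
    using compact_Int_closed[OF cpt_k] by simp
qed

lemma fibre_nonempty: "\<phi> -` {t} \<noteq> {}"
  using surj by (auto simp: surj_def vimage_def) metis

lemma phi_lo [simp]: "\<phi> (lo t) = t" and lo_le: "\<phi> x = t \<Longrightarrow> lo t \<le> x"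
proof -
  have "\<exists>x. \<phi> x = t \<and> (\<forall>y. \<phi> y = t \<longrightarrow> x \<le> y)"
    using compact_attains_inf[OF compact_fibre fibre_nonempty, of t] by auto
  from someI_ex[OF this] show "\<phi> (lo t) = t" "\<phi> x = t \<Longrightarrow> lo t \<le> x"
    by (auto simp: lo_def)
qed

lemma phi_hi [simp]: "\<phi> (hi t) = t" and le_hi: "\<phi> x = t \<Longrightarrow> x \<le> hi t"
proof -
  have "\<exists>x. \<phi> x = t \<and> (\<forall>y. \<phi> y = t \<longrightarrow> y \<le> x)"
    using compact_attains_sup[OF compact_fibre fibre_nonempty, of t] by auto
  from someI_ex[OF this] show "\<phi> (hi t) = t" "\<phi> x = t \<Longrightarrow> x \<le> hi t"
    by (auto simp: hi_def)
qed

lemma lo_le_hi: "lo t \<le> hi t"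
  by (rule lo_le) simp

lemma less_lo: "\<phi> x < t \<Longrightarrow> x < lo t"
  using monoD[OF mono, of "lo t" x] by (cases "lo t \<le> x") auto

lemma hi_less: "t < \<phi> x \<Longrightarrow> hi t < x"
  using monoD[OF mono, of x "hi t"] by (cases "x \<le> hi t") auto

definition jumps :: "'l set" where
  "jumps = {t. lo t < hi t}"

definition cut :: "'l \<Rightarrow> 'k \<Rightarrow>\<^sub>C real" where
  "cut t = (SOME u. (\<forall>x. 0 \<le> apply_bcontfun u x \<and> u x \<le> 1) \<and> (\<forall>x\<le>lo t. u x = 0) \<and> (\<forall>x\<ge>hi t. u x = 1))"

lemma cut:
  assumes "t \<in> jumps"
  shows "0 \<le> cut t x" "cut t x \<le> 1" "x \<le> lo t \<Longrightarrow> cut t x = 0" "hi t \<le> x \<Longrightarrow> cut t x = 1"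
proof -
  have "\<exists>u :: 'k \<Rightarrow>\<^sub>C real. (\<forall>x. 0 \<le> apply_bcontfun u x \<and> u x \<le> 1) \<and> (\<forall>x\<le>lo t. u x = 0) \<and> (\<forall>x\<ge>hi t. u x = 1)"
  proof -
    have "lo t < hi t" using assms by (simp add: jumps_def)
    then obtain u :: "'k \<Rightarrow>\<^sub>C real" where "\<And>x. 0 \<le> u x" "\<And>x. u x \<le> 1"
      "\<And>x. x \<le> lo t \<Longrightarrow> u x = 0" "\<And>x. hi t \<le> x \<Longrightarrow> u x = 1"
      using compact_line_separation[OF cpt_k] by metis
    then show ?thesis by (intro exI[of _ u]) simp
  qed
  from someI_ex[OF this]
  show "0 \<le> cut t x" "cut t x \<le> 1" "x \<le> lo t \<Longrightarrow> cut t x = 0" "hi t \<le> x \<Longrightarrow> cut t x = 1"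
    by (auto simp: cut_def)
qed

lemma cut_below: "t \<in> jumps \<Longrightarrow> \<phi> x < t \<Longrightarrow> cut t x = 0"
  by (intro cut(3) less_imp_le less_lo)

lemma cut_above: "t \<in> jumps \<Longrightarrow> t < \<phi> x \<Longrightarrow> cut t x = 1"
  by (intro cut(4) less_imp_le hi_less)

text \<open>The fibres are disjoint: wherever \<open>cut s\<close> is still below 1, the fibre of
  \<open>t\<close> has not been reached and \<open>cut t\<close> is 0.\<close>

lemma cut_antimono:
  assumes "s \<in> jumps" "t \<in> jumps" "s < t"
  shows "cut t x \<le> cut s x"
proof (cases "\<phi> x < t")
  case True
  then show ?thesis using cut_below[OF assms(2)] cut(1)[OF assms(1)] by simp
next
  case False
  then show ?thesis using cut_above[OF assms(1)] cut(2)[OF assms(2)] assms(3) by simp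
qed

definition jump :: "('k \<Rightarrow>\<^sub>C real) \<Rightarrow> 'l \<Rightarrow> real" where
  "jump h t = h (hi t) - h (lo t)"

lemma jump_add [simp]: "jump (h + h') t = jump h t + jump h' t"
  and jump_diff [simp]: "jump (h - h') t = jump h t - jump h' t"
  and jump_scaleR [simp]: "jump (c *\<^sub>R h) t = c * jump h t"
  and jump_sum [simp]: "jump (\<Sum>s\<in>F. v s) t = (\<Sum>s\<in>F. jump (v s) t)"
  by (auto simp: jump_def algebra_simps sum_subtractf)

lemma jump_cut: "t \<in> jumps \<Longrightarrow> jump (cut t) s = of_bool (s = t)"
  using cut_below[of t "hi s"] cut_below[of t "lo s"] cut_above[of t "hi s"] cut_above[of t "lo s"]
    cut(3)[of t "lo t"] cut(4)[of t "hi t"]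
  by (cases s t rule: linorder_cases) (auto simp: jump_def)

lemma comp_op_apply [simp]: "comp_op \<phi> g x = g (\<phi> x)"
proof -
  have "apply_bcontfun g \<circ> \<phi> \<in> bcontfun"
    using cont by (intro continuous_on_compact_bcontfun cpt_k continuous_on_compose) auto
  then show ?thesis
    by (simp add: comp_op_def Bcontfun_inverse)
qed

lemma comp_op_linear: "linear (comp_op \<phi>)"
  by (intro linearI bcontfun_eqI) auto

lemma norm_comp_op: "norm (comp_op \<phi> g) = norm g"
proof (rule antisym)
  show "norm (comp_op \<phi> g) \<le> norm g"
    by (rule norm_le_of_abs) (simp add: abs_apply_le_norm)
  have "\<bar>g t\<bar> \<le> norm (comp_op \<phi> g)" for t
    using abs_apply_le_norm[of "comp_op \<phi> g" "lo t"] by simp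
  then show "norm g \<le> norm (comp_op \<phi> g)"
    by (rule norm_le_of_abs)
qed

lemma jump_comp_op [simp]: "jump (comp_op \<phi> g) t = 0"
  by (simp add: jump_def)

section \<open>Approximation by functions with finitely many jumps\<close>

text \<open>A point that is not an end of its own fibre lies in the open interval between the two
  ends, and the complement is the union of these intervals.\<close>

lemma compact_ends: "compact (range lo \<union> range hi)"
proof -
  have eq: "- (range lo \<union> range hi) = (\<Union>t. {lo t<..<hi t})"
  proof (intro equalityI subsetI)
    fix x assume "x \<in> - (range lo \<union> range hi)"
    then have "x \<noteq> lo (\<phi> x)" "x \<noteq> hi (\<phi> x)" by auto
    then show "x \<in> (\<Union>t. {lo t<..<hi t})"
      using lo_le[of x] le_hi[of x] by (intro UN_I[of "\<phi> x"]) (auto simp: less_le)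
  next
    fix x assume "x \<in> (\<Union>t. {lo t<..<hi t})"
    then obtain t where t: "lo t < x" "x < hi t" by auto
    then have "\<phi> x = t"
      using monoD[OF mono, of "lo t" x] monoD[OF mono, of x "hi t"] by (auto intro: antisym)
    with t show "x \<in> - (range lo \<union> range hi)"
      by auto
  qed
  have "closed (range lo \<union> range hi)"
    unfolding closed_def eq by (intro open_UN ballI open_greaterThanLessThan)
  then show ?thesis
    using compact_Int_closed[OF cpt_k] by simp
qed

text \<open>The preimage of a closed set is the image under \<open>\<phi>\<close> of a compact set
  of endpoints, hence closed. Inside the fibres \<open>w\<close> may take any values.\<close>

lemma descend:
  fixes w :: "'k \<Rightarrow> real"
  assumes w: "continuous_on UNIV w" and eq: "\<And>t. w (lo t) = w (hi t)"
  obtains g :: "'l \<Rightarrow>\<^sub>C real" where "\<And>t. g t = w (lo t)"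
proof -
  have "continuous_on UNIV (\<lambda>t. w (lo t))"
    unfolding continuous_on_closed_vimage[OF closed_UNIV]
  proof (intro allI impI)
    fix B :: "real set" assume "closed B"
    then have "closed (w -` B)"
      using w by (intro continuous_closed_vimage) (auto simp: continuous_on_eq_continuous_at)
    then have "compact (\<phi> ` ((range lo \<union> range hi) \<inter> w -` B))"
      using cont by (intro compact_continuous_image compact_Int_closed compact_ends)
        (auto intro: continuous_on_subset)
    moreover have "\<phi> ` ((range lo \<union> range hi) \<inter> w -` B) = (\<lambda>t. w (lo t)) -` B \<inter> UNIV"
      using eq by (force simp: image_iff)
    ultimately show "closed ((\<lambda>t. w (lo t)) -` B \<inter> UNIV)"
      by (simp add: compact_imp_closed)
  qed
  then have "(\<lambda>t. w (lo t)) \<in> bcontfun"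
    by (rule continuous_on_compact_bcontfun[OF cpt_l])
  then show thesis
    by (intro that[of "Bcontfun (\<lambda>t. w (lo t))"]) (simp add: Bcontfun_inverse)
qed

definition simple :: "('l \<Rightarrow>\<^sub>C real) \<Rightarrow> 'l set \<Rightarrow> ('l \<Rightarrow> real) \<Rightarrow> 'k \<Rightarrow>\<^sub>C real" where
  "simple g F r = comp_op \<phi> g + (\<Sum>t\<in>F. r t *\<^sub>R cut t)"

text \<open>Stone--Weierstrass on the closed set of endpoints of the fibres, for the algebra of functions
  with finitely many jumps.\<close>

lemma simple_dense:
  assumes "0 < \<epsilon>"
  obtains g F r where "finite F" "F \<subseteq> jumps"
    "\<And>x. x \<in> range lo \<union> range hi \<Longrightarrow> \<bar>apply_bcontfun h x - simple g F r x\<bar> < \<epsilon>"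
proof -
  define A where "A = {u :: 'k \<Rightarrow> real. continuous_on UNIV u \<and> finite {t. u (lo t) \<noteq> u (hi t)}}"
  interpret function_ring_on A "range lo \<union> range hi"
  proof
    show "compact (range lo \<union> range hi)" by (rule compact_ends)
    show "continuous_on (range lo \<union> range hi) u" if "u \<in> A" for u
      using that by (auto simp: A_def intro: continuous_on_subset)
    show "(\<lambda>_. c) \<in> A" for c by (simp add: A_def)
    show "(\<lambda>x. u x + v x) \<in> A" if "u \<in> A" "v \<in> A" for u v
    proof -
      have "{t. u (lo t) + v (lo t) \<noteq> u (hi t) + v (hi t)}
          \<subseteq> {t. u (lo t) \<noteq> u (hi t)} \<union> {t. v (lo t) \<noteq> v (hi t)}" by auto
      then show ?thesis
        using that by (auto simp: A_def intro: continuous_on_add finite_subset)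
    qed
    show "(\<lambda>x. u x * v x) \<in> A" if "u \<in> A" "v \<in> A" for u v
    proof -
      have "{t. u (lo t) * v (lo t) \<noteq> u (hi t) * v (hi t)}
          \<subseteq> {t. u (lo t) \<noteq> u (hi t)} \<union> {t. v (lo t) \<noteq> v (hi t)}" by auto
      then show ?thesis
        using that by (auto simp: A_def intro: continuous_on_mult finite_subset)
    qed
    \<comment> \<open>The two ends of one fibre are separated by its cut, ends of different fibres
      by a function pulled back from L.\<close>
    show "\<exists>u\<in>A. u x \<noteq> u y" if xy: "x \<in> range lo \<union> range hi" "y \<in> range lo \<union> range hi" "x \<noteq> y" for x y
    proof (cases "\<phi> x = \<phi> y")
      case True
      then have "{x, y} = {lo (\<phi> x), hi (\<phi> x)}"
        using xy by auto
      then have t: "\<phi> x \<in> jumps" and "cut (\<phi> x) x \<noteq> cut (\<phi> x) y"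
        using xy(3) lo_le_hi[of "\<phi> x"] cut(3)[of "\<phi> x" "lo (\<phi> x)"] cut(4)[of "\<phi> x" "hi (\<phi> x)"]
        by (auto simp: jumps_def doubleton_eq_iff less_le)
      moreover have "{s. cut (\<phi> x) (lo s) \<noteq> cut (\<phi> x) (hi s)} \<subseteq> {\<phi> x}"
      proof clarify
        fix s assume "cut (\<phi> x) (lo s) \<noteq> cut (\<phi> x) (hi s)"
        then have "jump (cut (\<phi> x)) s \<noteq> 0" by (simp add: jump_def)
        then show "s = \<phi> x"
          using jump_cut[OF t, of s] by (simp add: of_bool_def split: if_splits)
      qed
      then have "apply_bcontfun (cut (\<phi> x)) \<in> A"
        by (auto simp: A_def intro: finite_subset)
      ultimately show ?thesis by blast
    next
      case False
      have sep: "\<exists>u :: 'l \<Rightarrow>\<^sub>C real. u s \<noteq> u t" if st: "s < t" for s t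
      proof -
        obtain u :: "'l \<Rightarrow>\<^sub>C real" where "u s = 0" "u t = 1"
          using compact_line_separation[OF cpt_l st] by (metis order_refl)
        then show ?thesis by (intro exI[of _ u]) simp
      qed
      obtain u :: "'l \<Rightarrow>\<^sub>C real" where "u (\<phi> x) \<noteq> u (\<phi> y)"
        using sep[of "\<phi> x" "\<phi> y"] sep[of "\<phi> y" "\<phi> x"] False by fastforce
      moreover have "apply_bcontfun (comp_op \<phi> u) \<in> A"
        using continuous_on_apply_bcontfun[of UNIV "comp_op \<phi> u"] by (simp add: A_def)
      ultimately show ?thesis
        by (intro bexI[of _ "apply_bcontfun (comp_op \<phi> u)"]) simp_all
    qed
  qed
  obtain u where u: "u \<in> A" and hu: "\<And>x. x \<in> range lo \<union> range hi \<Longrightarrow> \<bar>h x - u x\<bar> < \<epsilon>"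
    using Stone_Weierstrass_basic[of "apply_bcontfun h" \<epsilon>] assms by auto
  define F where "F = {t. u (lo t) \<noteq> u (hi t)}"
  define r where "r t = u (hi t) - u (lo t)" for t
  have F: "finite F" "F \<subseteq> jumps"
    using u lo_le_hi by (auto simp: F_def A_def jumps_def less_le)
  \<comment> \<open>Removing the finitely many jumps of \<open>u\<close> makes the endpoint values
    agree on every fibre, so the endpoint values of \<open>w\<close> descend to L. Inside a fibre
    \<open>u\<close> need not follow its cut, hence agreement is obtained at endpoints only.\<close>
  define w where "w x = u x - (\<Sum>t\<in>F. r t * cut t x)" for x
  have "continuous_on UNIV w"
    unfolding w_def using u by (auto simp: A_def intro!: continuous_intros)
  moreover have w_eq: "w (lo s) = w (hi s)" for s
  proof -
    have "(\<Sum>t\<in>F. r t * cut t (hi s)) - (\<Sum>t\<in>F. r t * cut t (lo s)) = (\<Sum>t\<in>F. r t * jump (cut t) s)"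
      by (simp add: jump_def sum_subtractf algebra_simps)
    also have "\<dots> = (\<Sum>t\<in>F. r t * of_bool (s = t))"
      using F by (intro sum.cong) (auto simp: jump_cut)
    also have "\<dots> = (if s \<in> F then r s else 0)"
      using F(1) by (simp add: of_bool_def if_distrib sum.delta cong: if_cong)
    also have "\<dots> = u (hi s) - u (lo s)"
      by (auto simp: F_def r_def)
    finally show ?thesis by (simp add: w_def)
  qed
  ultimately obtain g :: "'l \<Rightarrow>\<^sub>C real" where g: "\<And>t. g t = w (lo t)"
    using descend by metis
  have "simple g F r x = u x" if "x \<in> range lo \<union> range hi" for x
  proof -
    have "simple g F r x = w (lo (\<phi> x)) + (\<Sum>t\<in>F. r t * cut t x)"
      by (simp add: simple_def g)
    also have "w (lo (\<phi> x)) = w x"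
      using that by (auto simp: w_eq)
    finally show ?thesis
      by (simp add: w_def)
  qed
  with F hu show thesis
    by (intro that[of F g r]) auto
qed

section \<open>The norm-one projection interpolating across the fibres\<close>

text \<open>Continuity of the formula is not evident at this point; \<open>proj_apply\<close>
  provides it.\<close>

definition proj :: "('k \<Rightarrow>\<^sub>C real) \<Rightarrow> 'k \<Rightarrow>\<^sub>C real" where
  "proj h = Bcontfun (\<lambda>x. h (lo (\<phi> x)) + jump h (\<phi> x) * cut (\<phi> x) x)"

text \<open>On a nondegenerate fibre this is a convex combination of the two endpoint values. On a
  degenerate one the factor \<open>jump\<close> vanishes, whatever \<open>cut\<close> is
  there.\<close>

lemma interpolation_bound:
  assumes "\<And>x. x \<in> range lo \<union> range hi \<Longrightarrow> \<bar>apply_bcontfun h x\<bar> \<le> B"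
  shows "\<bar>h (lo (\<phi> x)) + jump h (\<phi> x) * cut (\<phi> x) x\<bar> \<le> B"
proof (cases "\<phi> x \<in> jumps")
  case True
  let ?c = "cut (\<phi> x) x"
  have "\<bar>h (lo (\<phi> x)) + jump h (\<phi> x) * ?c\<bar> = \<bar>(1 - ?c) * h (lo (\<phi> x)) + ?c * h (hi (\<phi> x))\<bar>"
    by (simp add: jump_def algebra_simps)
  also have "\<dots> \<le> (1 - ?c) * \<bar>h (lo (\<phi> x))\<bar> + ?c * \<bar>h (hi (\<phi> x))\<bar>"
    using cut(1,2)[OF True, of x] by (simp add: abs_mult order_trans[OF abs_triangle_ineq])
  also have "\<dots> \<le> (1 - ?c) * B + ?c * B"
    using cut(1,2)[OF True, of x] assms by (intro add_mono mult_left_mono) auto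
  finally show ?thesis by (simp add: algebra_simps)
next
  case False
  then have "jump h (\<phi> x) = 0"
    using lo_le_hi[of "\<phi> x"] by (simp add: jumps_def jump_def)
  then show ?thesis using assms by simp
qed

text \<open>Each cut is constant on every fibre but its own, and there it interpolates itself
  because its endpoint values are 0 and 1.\<close>

lemma interpolation_simple:
  assumes "F \<subseteq> jumps"
  shows "simple g F r (lo (\<phi> x)) + jump (simple g F r) (\<phi> x) * cut (\<phi> x) x = simple g F r x"
proof -
  have cut_eq: "cut t (lo (\<phi> x)) + jump (cut t) (\<phi> x) * cut (\<phi> x) x = cut t x" if t: "t \<in> jumps" for t
    using cut_below[OF t, of x] cut_below[OF t, of "lo (\<phi> x)"] cut_above[OF t, of x]
      cut_above[OF t, of "lo (\<phi> x)"] cut(3)[OF t, of "lo t"] jump_cut[OF t, of "\<phi> x"]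
    by (cases "\<phi> x" t rule: linorder_cases) auto
  have "(\<Sum>t\<in>F. r t * cut t (lo (\<phi> x))) + (\<Sum>t\<in>F. r t * jump (cut t) (\<phi> x)) * cut (\<phi> x) x
      = (\<Sum>t\<in>F. r t * (cut t (lo (\<phi> x)) + jump (cut t) (\<phi> x) * cut (\<phi> x) x))"
    by (simp add: sum.distrib sum_distrib_right distrib_left mult.assoc)
  also have "\<dots> = (\<Sum>t\<in>F. r t * cut t x)"
    using assms by (intro sum.cong) (auto simp: cut_eq)
  finally show ?thesis
    by (simp add: simple_def)
qed

text \<open>Interpolation fixes simple functions and is contractive for the supremum over the
  endpoints. Approximation at the endpoints thus becomes uniform approximation of the formula by
  continuous functions.\<close>

lemma proj_apply: "proj h x = h (lo (\<phi> x)) + jump h (\<phi> x) * cut (\<phi> x) x"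
proof -
  let ?p = "\<lambda>h x. apply_bcontfun h (lo (\<phi> x)) + jump h (\<phi> x) * cut (\<phi> x) x"
  have "\<exists>v. \<forall>x. \<bar>apply_bcontfun v x - ?p h x\<bar> \<le> 1 / real (Suc n)" for n
  proof -
    have "0 < 1 / real (Suc n)" by simp
    from simple_dense[OF this, of h] obtain g F r where F: "F \<subseteq> jumps"
      "\<And>x. x \<in> range lo \<union> range hi \<Longrightarrow> \<bar>apply_bcontfun h x - simple g F r x\<bar> < 1 / real (Suc n)"
      by metis
    have "\<bar>simple g F r x - ?p h x\<bar> \<le> 1 / real (Suc n)" for x
    proof -
      have "simple g F r x - ?p h x = ?p (simple g F r - h) x"
        using interpolation_simple[OF F(1), of g r x] by (simp add: algebra_simps)
      also have "\<bar>\<dots>\<bar> \<le> 1 / real (Suc n)"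
        using F(2) by (intro interpolation_bound) (auto simp: abs_minus_commute intro!: less_imp_le)
      finally show ?thesis .
    qed
    then show ?thesis by blast
  qed
  then obtain v :: "nat \<Rightarrow> 'k \<Rightarrow>\<^sub>C real" where v: "\<And>n x. \<bar>v n x - ?p h x\<bar> \<le> 1 / real (Suc n)"
    by metis
  have "uniform_limit UNIV (\<lambda>n. apply_bcontfun (v n)) (?p h) sequentially"
  proof (rule uniform_limitI)
    fix e :: real assume "0 < e"
    then obtain N where N: "1 / real (Suc N) < e"
      using nat_approx_posE by blast
    have "\<bar>v n x - ?p h x\<bar> < e" if "N \<le> n" for n x
    proof -
      have "1 / real (Suc n) \<le> 1 / real (Suc N)"
        using that by (simp add: frac_le)
      then show ?thesis using v[of n x] N by linarith
    qed
    then show "\<forall>\<^sub>F n in sequentially. \<forall>x\<in>UNIV. dist (v n x) (?p h x) < e"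
      by (auto simp: eventually_sequentially dist_real_def)
  qed
  then have "continuous_on UNIV (?p h)"
    by (rule uniform_limit_theorem[rotated]) auto
  then have "?p h \<in> bcontfun"
    by (rule continuous_on_compact_bcontfun[OF cpt_k])
  then show ?thesis
    by (simp add: proj_def Bcontfun_inverse)
qed

lemma proj_linear: "linear proj"
  by (intro linearI bcontfun_eqI) (auto simp: proj_apply algebra_simps)

lemma norm_proj_le:
  "(\<And>x. x \<in> range lo \<union> range hi \<Longrightarrow> \<bar>apply_bcontfun h x\<bar> \<le> B) \<Longrightarrow> norm (proj h) \<le> B"
  by (rule norm_le_of_abs, unfold proj_apply, rule interpolation_bound) blast

lemma proj_simple: "F \<subseteq> jumps \<Longrightarrow> proj (simple g F r) = simple g F r"
  by (rule bcontfun_eqI) (simp only: proj_apply interpolation_simple)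

lemma proj_comp_op: "proj (comp_op \<phi> g) = comp_op \<phi> g"
  by (rule bcontfun_eqI) (simp add: proj_apply)

subsection \<open>Ties and variation of a functional\<close>

text \<open>Comparability with all cuts is what makes \<open>sep\<close> below an ultrametric.\<close>

definition between :: "'l \<Rightarrow> 'l \<Rightarrow> ('k \<Rightarrow>\<^sub>C real) set" where
  "between s t = {u :: 'k \<Rightarrow>\<^sub>C real. (\<forall>x. cut t x \<le> u x \<and> u x \<le> cut s x) \<and>
     (\<forall>z\<in>jumps. (\<forall>x. u x \<le> cut z x) \<or> (\<forall>x. cut z x \<le> u x))}"

lemma cut_mono_le: "s \<in> jumps \<Longrightarrow> t \<in> jumps \<Longrightarrow> s \<le> t \<Longrightarrow> cut t x \<le> cut s x"
  using cut_antimono[of s t x] by (cases "s = t") auto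

lemma cut_in_between:
  assumes "s \<in> jumps" "z \<in> jumps" "t \<in> jumps" "s \<le> z" "z \<le> t"
  shows "cut z \<in> between s t"
  unfolding between_def using assms by (auto simp: cut_mono_le) (meson cut_mono_le linear)

lemma between_mono:
  assumes "s \<in> jumps" "s' \<in> jumps" "t \<in> jumps" "t' \<in> jumps" "s \<le> s'" "t' \<le> t"
  shows "between s' t' \<subseteq> between s t"
  unfolding between_def using cut_mono_le[OF assms(1,2,5)] cut_mono_le[OF assms(4,3,6)]
  by (clarsimp, meson order_trans)

lemma between_split:
  assumes "s \<in> jumps" "z \<in> jumps" "t \<in> jumps" "s < z" "z < t"
  shows "between s t \<subseteq> between s z \<union> between z t"
  unfolding between_def using assms by auto

definition sep :: "(('k \<Rightarrow>\<^sub>C real) \<Rightarrow> real) \<Rightarrow> 'l \<Rightarrow> 'l \<Rightarrow> real" where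
  "sep R s t = max 0 (max (INF u\<in>between s t. R u) (INF u\<in>between s t. - R u))"

lemma sep_nonneg: "0 \<le> sep R s t"
  by (simp add: sep_def)

text \<open>Subtracting from the cut at \<open>t\<close> a function pulled back from \<open>L\<close> that rises just before \<open>t\<close> makes
  the supports of finitely many cuts disjoint without changing the values of \<open>G\<close>.\<close>

lemma sum_abs_cut_le:
  assumes G: "linear G" and bd: "\<And>u. \<bar>G u\<bar> \<le> C * norm u" and C: "0 \<le> C"
    and null: "\<And>g. G (comp_op \<phi> g) = 0" and F: "finite F" "F \<subseteq> jumps"
  shows "(\<Sum>t\<in>F. \<bar>G (cut t)\<bar>) \<le> C"
proof -
  interpret G: linear G by fact
  \<comment> \<open>The test function is built from right to left; \<open>h\<close> vanishes up to
    the fibre of \<open>p\<close>, which leaves room for the summand belonging to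
    \<open>p\<close>.\<close>
  have tail: "\<exists>h. (\<forall>x. \<bar>apply_bcontfun h x\<bar> \<le> 1) \<and> (\<forall>x. \<phi> x \<le> p \<longrightarrow> h x = 0)
      \<and> G h = (\<Sum>t\<leftarrow>zs. \<bar>G (cut t)\<bar>)"
    if "sorted_wrt (<) (p # zs)" "set zs \<subseteq> jumps" for p zs
    using that
  proof (induction zs arbitrary: p)
    case Nil
    then show ?case by (intro exI[of _ 0]) (simp add: G.zero)
  next
    case (Cons t zs)
    then obtain h where h: "\<And>x. \<bar>apply_bcontfun h x\<bar> \<le> 1" "\<And>x. \<phi> x \<le> t \<Longrightarrow> h x = 0"
      "G h = (\<Sum>t\<leftarrow>zs. \<bar>G (cut t)\<bar>)"
      by (metis list.set_intros(2) set_subset_Cons sorted_wrt.simps(2) subset_trans)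
    have t: "t \<in> jumps" "p < t" using Cons.prems by auto
    obtain g :: "'l \<Rightarrow>\<^sub>C real" where g: "\<And>x. 0 \<le> g x" "\<And>x. g x \<le> 1"
      "\<And>x. x \<le> p \<Longrightarrow> g x = 0" "\<And>x. t \<le> x \<Longrightarrow> g x = 1"
      using compact_line_separation[OF cpt_l t(2)] by metis
    define h' where "h' = sgn (G (cut t)) *\<^sub>R (cut t - comp_op \<phi> g) + h"
    have "\<bar>h' x\<bar> \<le> 1 \<and> (\<phi> x \<le> p \<longrightarrow> h' x = 0)" for x
    proof (cases "\<phi> x \<le> t")
      case True
      have "\<bar>sgn (G (cut t)) * (cut t x - g (\<phi> x))\<bar> \<le> 1 * 1"
        unfolding abs_mult using cut(1,2)[OF t(1), of x] g(1,2)[of "\<phi> x"]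
        by (intro mult_mono) (auto simp: abs_sgn_eq)
      then show ?thesis
        using True h(2)[of x] cut_below[OF t(1), of x] g(3)[of "\<phi> x"] t(2) by (auto simp: h'_def)
    next
      case False
      then show ?thesis
        using h(1)[of x] cut_above[OF t(1), of x] g(4)[of "\<phi> x"] t(2) by (auto simp: h'_def)
    qed
    moreover have "G h' = \<bar>G (cut t)\<bar> + G h"
      by (simp add: h'_def G.add G.diff G.scale null sgn_mult_self_eq abs_sgn)
    ultimately show ?case
      using h(3) by (intro exI[of _ h']) simp
  qed
  define zs where "zs = sorted_list_of_set F"
  have zs: "sorted_wrt (<) zs" "set zs = F" "distinct zs"
    using F(1) by (auto simp: zs_def)
  have "\<exists>h. (\<forall>x. \<bar>apply_bcontfun h x\<bar> \<le> 1) \<and> G h = (\<Sum>t\<leftarrow>zs. \<bar>G (cut t)\<bar>)"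
  proof (cases zs)
    case Nil
    then show ?thesis by (intro exI[of _ 0]) (simp add: G.zero)
  next
    case (Cons t ys)
    then have t: "t \<in> jumps" using zs F by auto
    obtain h where h: "\<And>x. \<bar>apply_bcontfun h x\<bar> \<le> 1" "\<And>x. \<phi> x \<le> t \<Longrightarrow> h x = 0"
      "G h = (\<Sum>t\<leftarrow>ys. \<bar>G (cut t)\<bar>)"
      using tail[of t ys] Cons zs F by auto
    \<comment> \<open>The first point has no predecessor after which \<open>g\<close> could rise, so
      the constant 1 takes the place of \<open>g\<close>.\<close>
    define h' where "h' = sgn (G (cut t)) *\<^sub>R (cut t - comp_op \<phi> (const_bcontfun 1)) + h"
    have "\<bar>h' x\<bar> \<le> 1" for x
    proof (cases "\<phi> x \<le> t")
      case True
      have "\<bar>sgn (G (cut t)) * (cut t x - 1)\<bar> \<le> 1 * 1"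
        unfolding abs_mult using cut(1,2)[OF t, of x] by (intro mult_mono) (auto simp: abs_sgn_eq)
      then show ?thesis
        using True h(2)[of x] by (auto simp: h'_def)
    next
      case False
      then show ?thesis
        using h(1)[of x] cut_above[OF t, of x] by (auto simp: h'_def)
    qed
    moreover have "G h' = \<bar>G (cut t)\<bar> + G h"
      by (simp add: h'_def G.add G.diff G.scale null sgn_mult_self_eq abs_sgn)
    ultimately show ?thesis
      using h(3) Cons by (intro exI[of _ h']) simp
  qed
  then obtain h where h: "\<And>x. \<bar>apply_bcontfun h x\<bar> \<le> 1" "G h = (\<Sum>t\<leftarrow>zs. \<bar>G (cut t)\<bar>)"
    by auto
  have "(\<Sum>t\<in>F. \<bar>G (cut t)\<bar>) = G h"
    using h(2) zs by (simp add: sum_list_distinct_conv_sum_set)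
  also have "\<dots> \<le> C * norm h"
    using bd[of h] by simp
  also have "\<dots> \<le> C * 1"
    using C h(1) by (intro mult_left_mono norm_le_of_abs)
  finally show ?thesis by simp
qed

section \<open>Ties of a fixed functional\<close>

context
  fixes R :: "('k \<Rightarrow>\<^sub>C real) \<Rightarrow> real" and N :: real
  assumes R: "linear R" and R_bd: "\<And>u. \<bar>R u\<bar> \<le> N * norm u" and N: "0 \<le> N"
begin

lemma abs_R_between_le:
  assumes "s \<in> jumps" "t \<in> jumps" "u \<in> between s t"
  shows "\<bar>R u\<bar> \<le> N"
proof -
  have "norm u \<le> 1"
  proof (rule norm_le_of_abs)
    fix x
    have "cut t x \<le> u x" "u x \<le> cut s x" using assms(3) by (auto simp: between_def)
    then show "\<bar>u x\<bar> \<le> 1"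
      using cut(1)[OF assms(2), of x] cut(2)[OF assms(1), of x] by linarith
  qed
  then have "N * norm u \<le> N * 1"
    using N by (rule mult_left_mono)
  then show ?thesis using R_bd[of u] by simp
qed

lemma bdd_below_between:
  assumes "s \<in> jumps" "t \<in> jumps"
  shows "bdd_below (R ` between s t)" "bdd_below ((\<lambda>u. - R u) ` between s t)"
proof -
  have "- N \<le> R u" "- N \<le> - R u" if "u \<in> between s t" for u
    using abs_R_between_le[OF assms that] by linarith+
  then show "bdd_below (R ` between s t)" "bdd_below ((\<lambda>u. - R u) ` between s t)"
    by (auto intro!: bdd_belowI2[of _ "- N"])
qed

lemma sep_antimono:
  assumes "s \<in> jumps" "s' \<in> jumps" "t \<in> jumps" "t' \<in> jumps" "s \<le> s'" "s' \<le> t'" "t' \<le> t"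
  shows "sep R s t \<le> sep R s' t'"
proof -
  have ne: "between s' t' \<noteq> {}"
    using cut_in_between[of s' s' t'] assms by auto
  have sub: "between s' t' \<subseteq> between s t"
    using assms by (intro between_mono)
  show ?thesis
    unfolding sep_def using assms
    by (intro max.mono order_refl cINF_superset_mono ne sub bdd_below_between)
qed

lemma sep_pos_cases:
  assumes "s \<in> jumps" "t \<in> jumps" "\<delta> \<le> sep R s t" "0 < \<delta>"
  shows "(\<forall>u\<in>between s t. \<delta> \<le> R u) \<or> (\<forall>u\<in>between s t. \<delta> \<le> - R u)"
proof -
  have "\<delta> \<le> (INF u\<in>between s t. R u) \<or> \<delta> \<le> (INF u\<in>between s t. - R u)"
    using assms(3,4) unfolding sep_def by (auto simp: le_max_iff_disj)
  moreover have "(INF u\<in>between s t. R u) \<le> R u" "(INF u\<in>between s t. - R u) \<le> - R u"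
    if "u \<in> between s t" for u
    using that assms by (auto intro!: cINF_lower bdd_below_between)
  ultimately show ?thesis by (meson order_trans)
qed

lemma sep_geI:
  assumes "s \<in> jumps" "t \<in> jumps" "s \<le> t"
    and "(\<forall>u\<in>between s t. \<delta> \<le> R u) \<or> (\<forall>u\<in>between s t. \<delta> \<le> - R u)"
  shows "\<delta> \<le> sep R s t"
proof -
  have ne: "between s t \<noteq> {}"
    using cut_in_between[of s s t] assms by auto
  show ?thesis
    using assms(4)
  proof
    assume "\<forall>u\<in>between s t. \<delta> \<le> R u"
    then have "\<delta> \<le> (INF u\<in>between s t. R u)" by (intro cINF_greatest ne) auto
    then show ?thesis by (simp add: sep_def le_max_iff_disj)
  next
    assume "\<forall>u\<in>between s t. \<delta> \<le> - R u"
    then have "\<delta> \<le> (INF u\<in>between s t. - R u)" by (intro cINF_greatest ne) auto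
    then show ?thesis by (simp add: sep_def le_max_iff_disj)
  qed
qed

text \<open>\<open>cut z\<close> lies in both intervals, so a positive bound must hold on them with
  the same sign. By \<open>between_split\<close> it then holds throughout between \<open>s\<close>
  and \<open>t\<close>.\<close>

lemma sep_ultrametric:
  assumes J: "s \<in> jumps" "z \<in> jumps" "t \<in> jumps" and "s < z" "z < t"
  shows "min (sep R s z) (sep R z t) \<le> sep R s t"
proof (cases "0 < min (sep R s z) (sep R z t)")
  case False
  then show ?thesis using sep_nonneg[of R s t] by linarith
next
  case True
  define \<delta> where "\<delta> = min (sep R s z) (sep R z t)"
  have "0 < \<delta>" "\<delta> \<le> sep R s z" "\<delta> \<le> sep R z t"
    using True by (auto simp: \<delta>_def)
  note cases = sep_pos_cases[OF J(1,2) this(2,1)] sep_pos_cases[OF J(2,3) this(3,1)]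
  have "cut z \<in> between s z" "cut z \<in> between z t"
    using assms by (auto intro!: cut_in_between)
  then have "(\<forall>u\<in>between s z \<union> between z t. \<delta> \<le> R u) \<or> (\<forall>u\<in>between s z \<union> between z t. \<delta> \<le> - R u)"
    using cases \<open>0 < \<delta>\<close> by fastforce
  then have "(\<forall>u\<in>between s t. \<delta> \<le> R u) \<or> (\<forall>u\<in>between s t. \<delta> \<le> - R u)"
    using between_split[OF assms] by blast
  then show ?thesis
    using assms unfolding \<delta>_def[symmetric] by (intro sep_geI) auto
qed

section \<open>Variation of the functional along the cuts\<close>

text \<open>If \<open>R\<close> has the same sign at both cuts, some \<open>u\<close> brings it, in
  that sign, below the tie plus \<eta>/2, and the detour through \<open>u\<close> is long enough.
  For opposite signs the direct path is.\<close>

lemma exists_between_separating: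
  assumes J: "s \<in> jumps" "t \<in> jumps" and "s < t" "0 < \<eta>"
  obtains u where "u \<in> between s t"
    "\<bar>R (cut s)\<bar> + \<bar>R (cut t)\<bar> - 2 * sep R s t - \<eta> \<le> \<bar>R (cut s) - R u\<bar> + \<bar>R u - R (cut t)\<bar>"
proof -
  have s: "cut s \<in> between s t"
    using assms by (intro cut_in_between) auto
  have *: "\<exists>u\<in>between s t. R u < sep R s t + \<eta> / 2" "\<exists>u\<in>between s t. - R u < sep R s t + \<eta> / 2"
  proof -
    have "(INF u\<in>between s t. R u) < sep R s t + \<eta> / 2" "(INF u\<in>between s t. - R u) < sep R s t + \<eta> / 2"
      using \<open>0 < \<eta>\<close> by (auto simp: sep_def)
    then show "\<exists>u\<in>between s t. R u < sep R s t + \<eta> / 2" "\<exists>u\<in>between s t. - R u < sep R s t + \<eta> / 2"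
      using s cInf_lessD[of "R ` between s t"] cInf_lessD[of "(\<lambda>u. - R u) ` between s t"] by blast+
  qed
  consider "0 \<le> R (cut s)" "0 \<le> R (cut t)" | "R (cut s) \<le> 0" "R (cut t) \<le> 0"
    | "0 \<le> R (cut s)" "R (cut t) \<le> 0" | "R (cut s) \<le> 0" "0 \<le> R (cut t)"
    by linarith
  then show thesis
  proof cases
    case 1
    obtain u where "u \<in> between s t" "R u < sep R s t + \<eta> / 2" using *(1) by blast
    then show ?thesis using 1 by (intro that[of u]) linarith+
  next
    case 2
    obtain u where "u \<in> between s t" "- R u < sep R s t + \<eta> / 2" using *(2) by blast
    then show ?thesis using 2 by (intro that[of u]) linarith+
  next
    case 3
    then show ?thesis using s sep_nonneg[of R s t] \<open>0 < \<eta>\<close> by (intro that[of "cut s"]) linarith+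
  next
    case 4
    then show ?thesis using s sep_nonneg[of R s t] \<open>0 < \<eta>\<close> by (intro that[of "cut s"]) linarith+
  qed
qed

text \<open>The nonnegative differences \<open>cut s - u\<close>, \<open>u - cut t\<close> and so
  on, down to 0, add up to \<open>cut s\<close>; each gets the sign of its value under
  \<open>R\<close>. Every height but the first is counted twice, on arriving and on leaving.\<close>

lemma exists_variation_test:
  fixes \<eta> :: real
  assumes "sorted_wrt (<) (s # zs)" "set (s # zs) \<subseteq> jumps" "0 < \<eta>"
  shows "\<exists>h. (\<forall>x. \<bar>apply_bcontfun h x\<bar> \<le> cut s x) \<and>
    2 * (\<Sum>t\<leftarrow>s # zs. \<bar>R (cut t)\<bar>) - \<bar>R (cut s)\<bar> - 2 * steps (sep R) (s # zs) - \<eta> * real (length zs) \<le> R h"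
  using assms
proof (induction zs arbitrary: s)
  case Nil
  have "R (sgn (R (cut s)) *\<^sub>R cut s) = \<bar>R (cut s)\<bar>"
    by (simp add: linear_scale[OF R] abs_sgn)
  then show ?case
    using Nil cut(1)[of s] by (intro exI[of _ "sgn (R (cut s)) *\<^sub>R cut s"]) (auto simp: abs_mult abs_sgn_eq)
next
  case (Cons t zs)
  have st: "s \<in> jumps" "t \<in> jumps" "s < t"
    using Cons.prems by auto
  have "sorted_wrt (<) (t # zs)" "set (t # zs) \<subseteq> jumps"
    using Cons.prems by auto
  from Cons.IH[OF this \<open>0 < \<eta>\<close>] obtain h where h: "\<And>x. \<bar>apply_bcontfun h x\<bar> \<le> cut t x"
    "2 * (\<Sum>t\<leftarrow>t # zs. \<bar>R (cut t)\<bar>) - \<bar>R (cut t)\<bar> - 2 * steps (sep R) (t # zs) - \<eta> * real (length zs) \<le> R h"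
    by auto
  obtain u where u: "u \<in> between s t"
    "\<bar>R (cut s)\<bar> + \<bar>R (cut t)\<bar> - 2 * sep R s t - \<eta> \<le> \<bar>R (cut s) - R u\<bar> + \<bar>R u - R (cut t)\<bar>"
    using exists_between_separating[OF st \<open>0 < \<eta>\<close>] .
  define h' where "h' = sgn (R (cut s) - R u) *\<^sub>R (cut s - u) + sgn (R u - R (cut t)) *\<^sub>R (u - cut t) + h"
  have sgn: "\<bar>sgn a * b\<bar> \<le> b" if "0 \<le> b" for a b :: real
    using that by (simp add: abs_mult abs_sgn_eq)
  have "\<bar>h' x\<bar> \<le> cut s x" for x
  proof -
    have "cut t x \<le> u x" "u x \<le> cut s x"
      using u(1) by (auto simp: between_def)
    then show ?thesis
      using h(1)[of x] sgn[of "cut s x - u x" "R (cut s) - R u"] sgn[of "u x - cut t x" "R u - R (cut t)"]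
      unfolding h'_def plus_bcontfun.rep_eq minus_bcontfun.rep_eq scaleR_bcontfun.rep_eq real_scaleR_def
      by linarith
  qed
  moreover have "R h' = \<bar>R (cut s) - R u\<bar> + \<bar>R u - R (cut t)\<bar> + R h"
    by (simp add: h'_def linear_add[OF R] linear_scale[OF R] linear_diff[OF R] abs_sgn mult.commute)
  ultimately show ?case
    using h(2) u(2) by (intro exI[of _ h']) (simp add: algebra_simps)
qed

text \<open>A step from the constant 1 to the first cut completes the chain, whose variation is at
  most \<open>N\<close>. It supplies the second copy of the first height, up to
  \<open>\<bar>R (const_bcontfun 1)\<bar>\<close>.\<close>

lemma variation_bound:
  assumes "sorted_wrt (<) zs" "set zs \<subseteq> jumps"
  shows "2 * (\<Sum>t\<leftarrow>zs. \<bar>R (cut t)\<bar>) \<le> N + \<bar>R (const_bcontfun 1)\<bar> + 2 * steps (sep R) zs"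
proof (cases zs)
  case Nil
  then show ?thesis using N by simp
next
  case (Cons s ys)
  then have s: "s \<in> jumps" using assms by simp
  show ?thesis
  proof (rule field_le_epsilon)
    fix e :: real assume e: "0 < e"
    \<comment> \<open>One error \<eta> is spent per gap; \<open>Suc\<close> avoids division by zero
      for a single point.\<close>
    define \<eta> where "\<eta> = e / real (Suc (length ys))"
    have \<eta>: "0 < \<eta>" "\<eta> * real (length ys) \<le> e"
      using e by (auto simp: \<eta>_def field_simps)
    obtain h where h: "\<And>x. \<bar>apply_bcontfun h x\<bar> \<le> cut s x"
      "2 * (\<Sum>t\<leftarrow>zs. \<bar>R (cut t)\<bar>) - \<bar>R (cut s)\<bar> - 2 * steps (sep R) zs - \<eta> * real (length ys) \<le> R h"
      using exists_variation_test[of s ys \<eta>] assms \<eta>(1) Cons by auto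
    let ?d = "R (const_bcontfun 1 - cut s)"
    define h' where "h' = sgn ?d *\<^sub>R (const_bcontfun 1 - cut s) + h"
    have "\<bar>h' x\<bar> \<le> 1" for x
    proof -
      have "\<bar>sgn ?d * (1 - cut s x)\<bar> \<le> 1 - cut s x"
        using cut(2)[OF s, of x] by (simp add: abs_mult abs_sgn_eq)
      then show ?thesis
        using h(1)[of x] by (simp add: h'_def)
    qed
    then have "N * norm h' \<le> N * 1"
      using N by (intro mult_left_mono norm_le_of_abs)
    moreover have "R h' = \<bar>?d\<bar> + R h"
      by (simp only: h'_def linear_add[OF R] linear_scale[OF R]) (simp add: abs_sgn mult.commute)
    moreover have "?d = R (const_bcontfun 1) - R (cut s)"
      by (rule linear_diff[OF R])
    ultimately show "2 * (\<Sum>t\<leftarrow>zs. \<bar>R (cut t)\<bar>) \<le> N + \<bar>R (const_bcontfun 1)\<bar> + 2 * steps (sep R) zs + e"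
      using R_bd[of h'] h(2) \<eta>(2) by linarith
  qed
qed

end

subsection \<open>The extension\<close>

text \<open>If only finitely many jumps lie between \<open>s\<close> and \<open>t\<close>, then some function pulled back from \<open>L\<close> lies
  in \<open>between s t\<close>. If infinitely many do, then \<open>R i\<close> being large at all of them contradicts \<open>sum_le\<close>.\<close>

lemma sep_c0:
  fixes T :: "('l \<Rightarrow>\<^sub>C real) \<Rightarrow> 'i \<Rightarrow> real" and S :: "('k \<Rightarrow>\<^sub>C real) \<Rightarrow> 'i \<Rightarrow> real"
  assumes R: "\<And>i. linear (R i)" "\<And>i u. \<bar>R i u\<bar> \<le> N * norm u" "0 \<le> N"
    and R_ext: "\<And>i g. R i (comp_op \<phi> g) = T g i"
    and T: "\<And>g. T g \<in> c0" and S: "\<And>h. S h \<in> c0"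
    and sum_le: "\<And>i F. finite F \<Longrightarrow> F \<subseteq> jumps \<Longrightarrow> (\<Sum>t\<in>F. \<bar>S (cut t) i - R i (cut t)\<bar>) \<le> C"
    and st: "s \<in> jumps" "t \<in> jumps" "s < t"
  shows "(\<lambda>i. sep (R i) s t) \<in> c0"
proof (rule c0I)
  fix \<delta> :: real assume \<delta>: "0 < \<delta>"
  have large: "\<delta> \<le> \<bar>R i u\<bar>" if "\<delta> \<le> \<bar>sep (R i) s t\<bar>" "u \<in> between s t" for i u
  proof -
    have "\<delta> \<le> sep (R i) s t"
      using that(1) sep_nonneg[of "R i" s t] by simp
    then show ?thesis
      using sep_pos_cases[OF R(1,2,3) st(1,2) _ \<delta>] that(2) by (meson abs_ge_minus_self abs_ge_self order_trans)
  qed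
  show "finite {i. \<delta> \<le> \<bar>sep (R i) s t\<bar>}"
  proof (cases "finite (jumps \<inter> {s..t})")
    case True
    let ?Z = "jumps \<inter> {s<..t}"
    have "finite ?Z" "t \<in> ?Z"
      using st by (auto intro!: finite_subset[OF _ True])
    \<comment> \<open>\<open>z\<close> is the next jump after \<open>s\<close>. A function from L
      that rises between \<open>s\<close> and \<open>z\<close> is comparable with every cut.\<close>
    define z where "z = Min ?Z"
    have "z \<in> ?Z"
      unfolding z_def using \<open>finite ?Z\<close> \<open>t \<in> ?Z\<close> by (intro Min_in) blast+
    have z_le: "z \<le> y" if "y \<in> ?Z" for y
      unfolding z_def using \<open>finite ?Z\<close> that by (rule Min_le)
    have z: "z \<in> jumps" "s < z" "z \<le> t" using \<open>z \<in> ?Z\<close> by auto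
    obtain g :: "'l \<Rightarrow>\<^sub>C real" where g: "\<And>x. 0 \<le> g x" "\<And>x. g x \<le> 1"
      "\<And>x. x \<le> s \<Longrightarrow> g x = 0" "\<And>x. z \<le> x \<Longrightarrow> g x = 1"
      using compact_line_separation[OF cpt_l z(2)] by metis
    have below: "g (\<phi> x) \<le> cut s x" for x
      using g(2)[of "\<phi> x"] g(3)[of "\<phi> x"] cut(1)[OF st(1), of x] cut_above[OF st(1), of x]
      by (cases "\<phi> x \<le> s") auto
    have above: "cut y x \<le> g (\<phi> x)" if "y \<in> jumps" "z \<le> y" for x y
      using g(1)[of "\<phi> x"] g(4)[of "\<phi> x"] cut(2)[OF that(1), of x] cut_below[OF that(1), of x] that(2)
      by (cases "\<phi> x < z") auto
    have "(\<forall>x. g (\<phi> x) \<le> cut y x) \<or> (\<forall>x. cut y x \<le> g (\<phi> x))" if y: "y \<in> jumps" for y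
    proof (cases "y \<le> s")
      case True
      then show ?thesis
        using below cut_mono_le[OF y st(1)] by (auto intro: order_trans)
    next
      case False
      then have "z \<le> y"
        using z_le[of y] z y by (cases "y \<le> t") auto
      then show ?thesis
        using above[OF y] by simp
    qed
    then have "comp_op \<phi> g \<in> between s t"
      unfolding between_def using below above[OF st(2) z(3)] by simp
    from large[OF _ this] have "{i. \<delta> \<le> \<bar>sep (R i) s t\<bar>} \<subseteq> {i. \<delta> \<le> \<bar>T g i\<bar>}"
      by (auto simp: R_ext)
    then show ?thesis
      using c0D[OF T \<delta>] finite_subset by blast
  next
    case False
    \<comment> \<open>Differences of \<delta>/2 between \<open>S\<close> and \<open>R\<close> at
      \<open>n\<close> points would exceed \<open>C\<close>, so for each relevant \<open>i\<close>
      one of the \<open>n\<close> values of \<open>S\<close> is at least \<delta>/2 in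
      modulus.\<close>
    obtain n :: nat where n: "2 * C / \<delta> < n"
      using reals_Archimedean2 by blast
    obtain F where F: "finite F" "card F = n" "F \<subseteq> jumps \<inter> {s..t}"
      using infinite_arbitrarily_large[OF False] by blast
    have "{i. \<delta> \<le> \<bar>sep (R i) s t\<bar>} \<subseteq> (\<Union>z\<in>F. {i. \<delta> / 2 \<le> \<bar>S (cut z) i\<bar>})"
    proof (rule ccontr)
      assume "\<not> ?thesis"
      then obtain i where i: "\<delta> \<le> \<bar>sep (R i) s t\<bar>" and "i \<notin> (\<Union>z\<in>F. {i. \<delta> / 2 \<le> \<bar>S (cut z) i\<bar>})"
        by blast
      then have small: "\<bar>S (cut z) i\<bar> < \<delta> / 2" if "z \<in> F" for z
        using that by (meson UN_I leI mem_Collect_eq)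
      have "\<delta> / 2 \<le> \<bar>S (cut z) i - R i (cut z)\<bar>" if z: "z \<in> F" for z
      proof -
        have "cut z \<in> between s t"
          using F(3) z st by (intro cut_in_between) auto
        from large[OF i this] small[OF z] show ?thesis by linarith
      qed
      then have "(\<Sum>z\<in>F. \<delta> / 2) \<le> (\<Sum>z\<in>F. \<bar>S (cut z) i - R i (cut z)\<bar>)"
        by (rule sum_mono)
      also have "\<dots> \<le> C"
        using F by (intro sum_le) auto
      finally have "real n * (\<delta> / 2) \<le> C"
        using F(2) by simp
      then show False
        using n \<delta> by (simp add: field_simps)
    qed
    moreover have "finite (\<Union>z\<in>F. {i. \<delta> / 2 \<le> \<bar>S (cut z) i\<bar>})"
      using F(1) \<delta> by (intro finite_UN_I c0D S) auto
    ultimately show ?thesis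
      by (rule finite_subset)
  qed
qed

section \<open>Choice of the jump coefficients\<close>

text \<open>On relevant points \<open>d i t\<close> is \<open>- R i (cut t)\<close> shrunk by a null
  amount, which is all that remains after the correction. The shrinkage dominates the ties in
  \<open>variation_bound\<close> through \<open>steps_le_sum\<close>.\<close>

lemma exists_jump_coefficients:
  fixes T :: "('l \<Rightarrow>\<^sub>C real) \<Rightarrow> 'i \<Rightarrow> real" and S :: "('k \<Rightarrow>\<^sub>C real) \<Rightarrow> 'i \<Rightarrow> real"
  assumes R: "\<And>i. linear (R i)" "\<And>i u. \<bar>R i u\<bar> \<le> N * norm u" "0 \<le> N"
    and R_ext: "\<And>i g. R i (comp_op \<phi> g) = T g i"
    and T: "\<And>g. T g \<in> c0" and S: "\<And>h. S h \<in> c0"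
    and sum_le: "\<And>i F. finite F \<Longrightarrow> F \<subseteq> jumps \<Longrightarrow> (\<Sum>t\<in>F. \<bar>S (cut t) i - R i (cut t)\<bar>) \<le> C"
  obtains d :: "'i \<Rightarrow> 'l \<Rightarrow> real"
  where "\<And>i F. finite F \<Longrightarrow> F \<subseteq> jumps \<Longrightarrow> 2 * (\<Sum>t\<in>F. \<bar>d i t\<bar>) \<le> N"
    "\<And>t. t \<in> jumps \<Longrightarrow> (\<lambda>i. R i (cut t) + d i t) \<in> c0"
proof -
  \<comment> \<open>Off \<open>A i\<close> the value \<open>R i (cut t)\<close> equals
    \<open>S (cut t) i\<close>, which is null, and no correction is made. The bounded sums make
    \<open>A i\<close> countable.\<close>
  define A where "A i = {t \<in> jumps. S (cut t) i - R i (cut t) \<noteq> 0}" for i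
  have "(\<lambda>t. norm (S (cut t) i - R i (cut t))) summable_on jumps" for i
    unfolding Infinite_Sum.abs_summable_iff_bdd_above using sum_le[of _ i] by (auto intro!: bdd_aboveI2[of _ _ C])
  then have A: "countable (A i)" for i
    unfolding A_def by (rule Infinite_Sum.abs_summable_countable)
  have A_jumps: "A i \<subseteq> jumps" for i
    by (auto simp: A_def)
  have sep_c0: "(\<lambda>i. sep (R i) x y) \<in> c0" if "x \<in> jumps" "y \<in> jumps" "x < y" for x y
    by (rule sep_c0[where R = R and T = T and S = S and N = N and C = C])
      (simp_all add: R R_ext T S sum_le that)
  obtain e :: "'l \<Rightarrow> nat" and B where B: "\<And>q. finite (B q)" "\<And>q. q \<in> jumps \<Longrightarrow> B q \<subseteq> jumps - {q}"
    "\<And>i x y. x \<in> A i \<Longrightarrow> y \<in> A i \<Longrightarrow> x < y \<Longrightarrow> 0 < sep (R i) x y \<Longrightarrow> e x \<le> e y \<Longrightarrow> x \<in> B y"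
    "\<And>i x y. x \<in> A i \<Longrightarrow> y \<in> A i \<Longrightarrow> x < y \<Longrightarrow> 0 < sep (R i) x y \<Longrightarrow> e y \<le> e x \<Longrightarrow> y \<in> B x"
  proof (rule exists_local_enumeration[where Q = jumps and A = A and m = "\<lambda>i. sep (R i)"])
    show "A i \<subseteq> jumps" "countable (A i)" for i by (fact A_jumps A)+
    show "(\<lambda>i. sep (R i) x y) \<in> c0" if "x \<in> jumps" "y \<in> jumps" "x < y" for x y
      using that by (rule sep_c0)
    show "sep (R i) x z \<le> sep (R i) x y"
      if "x \<in> jumps" "y \<in> jumps" "z \<in> jumps" "x < y" "y \<le> z" for i x y z
      using that by (intro sep_antimono[OF R]) auto
    show "sep (R i) x z \<le> sep (R i) y z"
      if "x \<in> jumps" "y \<in> jumps" "z \<in> jumps" "x \<le> y" "y < z" for i x y z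
      using that by (intro sep_antimono[OF R]) auto
  qed (rule that, assumption+)
  \<comment> \<open>A finite sum replaces the largest tie: it dominates each of them and is null in
    \<open>i\<close>. \<open>min\<close> and \<open>max\<close> put the pair in order.\<close>
  define M where "M i z = (\<Sum>x\<in>B z. sep (R i) (min x z) (max x z))" for i z
  have M_nonneg: "0 \<le> M i z" for i z
    unfolding M_def by (intro sum_nonneg sep_nonneg)
  have M_c0: "(\<lambda>i. M i z) \<in> c0" if z: "z \<in> jumps" for z
    unfolding M_def
  proof (rule c0_sum)
    fix x assume "x \<in> B z"
    then have "x \<in> jumps" "x \<noteq> z" using B(2)[OF z] by auto
    then show "(\<lambda>i. sep (R i) (min x z) (max x z)) \<in> c0"
      using z by (intro sep_c0) (auto simp: min_def max_def)
  qed
  \<comment> \<open>\<open>\<tau> i\<close> pays for the term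
    \<open>\<bar>R i (const_bcontfun 1)\<bar>\<close> of \<open>variation_bound\<close>. It is null
    because the constant is pulled back from L.\<close>
  define \<tau> where "\<tau> i = \<bar>T (const_bcontfun 1) i\<bar>" for i
  have "comp_op \<phi> (const_bcontfun 1) = const_bcontfun 1"
    by (rule bcontfun_eqI) simp
  then have \<tau>: "\<bar>R i (const_bcontfun 1)\<bar> = \<tau> i" for i
    using R_ext[of i "const_bcontfun 1"] by (simp add: \<tau>_def)
  define d where "d i t = (if t \<in> A i
      then - sgn (R i (cut t)) * max 0 (\<bar>R i (cut t)\<bar> - M i t - \<tau> i) else 0)" for i t
  show thesis
  proof
    fix t assume t: "t \<in> jumps"
    have bd: "\<bar>R i (cut t) + d i t\<bar> \<le> \<bar>\<bar>S (cut t) i\<bar> + (M i t + \<tau> i)\<bar>" for i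
    proof (cases "t \<in> A i")
      case True
      have "\<bar>r - sgn r * max 0 (\<bar>r\<bar> - m)\<bar> \<le> m" if "0 \<le> m" for r m :: real
        using that by (auto simp: sgn_if max_def)
      from this[of "M i t + \<tau> i" "R i (cut t)"]
      have "\<bar>R i (cut t) - sgn (R i (cut t)) * max 0 (\<bar>R i (cut t)\<bar> - (M i t + \<tau> i))\<bar> \<le> M i t + \<tau> i"
        using M_nonneg[of i t] by (simp add: \<tau>_def)
      moreover have "R i (cut t) + d i t
          = R i (cut t) - sgn (R i (cut t)) * max 0 (\<bar>R i (cut t)\<bar> - (M i t + \<tau> i))"
        using True by (simp add: d_def diff_diff_eq)
      ultimately show ?thesis
        by linarith
    next
      case False
      then have "R i (cut t) = S (cut t) i" using t by (simp add: A_def)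
      then show ?thesis
        using False M_nonneg[of i t] by (simp add: d_def \<tau>_def)
    qed
    have "(\<lambda>i. \<bar>S (cut t) i\<bar> + (M i t + \<tau> i)) \<in> c0"
      unfolding \<tau>_def by (intro c0_add c0_abs S T M_c0 t)
    then show "(\<lambda>i. R i (cut t) + d i t) \<in> c0"
      using bd by (rule c0_mono)
  next
    fix i F assume F: "finite F" "F \<subseteq> jumps"
    \<comment> \<open>Where the shrunk value survives, the full shrinkage has been subtracted
      (\<open>d_eq\<close>), and the point lies in \<open>A i\<close>, as the properties of
      \<open>B\<close> require.\<close>
    define P where "P = {t \<in> F. d i t \<noteq> 0}"
    have P: "finite P" "P \<subseteq> jumps" "P \<subseteq> A i"
      using F by (auto simp: P_def d_def)
    have sum_P: "(\<Sum>t\<in>F. \<bar>d i t\<bar>) = (\<Sum>t\<in>P. \<bar>d i t\<bar>)"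
      using F by (intro sum.mono_neutral_right) (auto simp: P_def)
    show "2 * (\<Sum>t\<in>F. \<bar>d i t\<bar>) \<le> N"
    proof (cases "P = {}")
      case True
      then show ?thesis using R(3) by (simp add: sum_P)
    next
      case False
      have d_eq: "\<bar>d i t\<bar> = \<bar>R i (cut t)\<bar> - M i t - \<tau> i" if "t \<in> P" for t
        using that by (auto simp: P_def d_def abs_mult abs_sgn_eq max_def split: if_splits)
      define zs where "zs = sorted_list_of_set P"
      have zs: "sorted_wrt (<) zs" "set zs = P" "distinct zs"
        using P(1) by (auto simp: zs_def)
      have term_le: "sep (R i) (min x z) (max x z) \<le> M i z" if "x \<in> B z" for x z
        unfolding M_def using that B(1) by (intro member_le_sum) (auto simp: sep_nonneg)
      have "steps (sep (R i)) zs \<le> sum (M i) (set zs)"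
      proof (rule steps_le_sum[where e = e])
        show "sorted_wrt (<) zs" by fact
        show "min (sep (R i) x z) (sep (R i) z y) \<le> sep (R i) x y"
          if "x \<in> set zs" "z \<in> set zs" "y \<in> set zs" "x < z" "z < y" for x y z
          using that P zs by (intro sep_ultrametric[OF R]) auto
        show "0 \<le> M i z" for z by (rule M_nonneg)
        fix x y assume xy: "x \<in> set zs" "y \<in> set zs" "x < y"
        then have mem: "x \<in> A i" "y \<in> A i" using P zs by auto
        show "sep (R i) x y \<le> M i y" if "e x \<le> e y"
          using B(3)[OF mem xy(3) _ that] term_le[of x y] xy(3) M_nonneg[of i y]
          by (cases "0 < sep (R i) x y") auto
        show "sep (R i) x y \<le> M i x" if "e y \<le> e x"
          using B(4)[OF mem xy(3) _ that] term_le[of y x] xy(3) M_nonneg[of i x]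
          by (cases "0 < sep (R i) x y") (auto simp: min.commute max.commute)
      qed
      moreover have "2 * (\<Sum>t\<leftarrow>zs. \<bar>R i (cut t)\<bar>) \<le> N + \<tau> i + 2 * steps (sep (R i)) zs"
        using variation_bound[OF R zs(1)] zs(2) P(2) \<tau> by simp
      moreover have "(\<Sum>t\<leftarrow>zs. \<bar>R i (cut t)\<bar>) = (\<Sum>t\<in>P. \<bar>R i (cut t)\<bar>)"
        using zs by (simp add: sum_list_distinct_conv_sum_set)
      moreover have "(\<Sum>t\<in>P. \<bar>d i t\<bar>) = (\<Sum>t\<in>P. \<bar>R i (cut t)\<bar>) - sum (M i) P - card P * \<tau> i"
        by (simp add: d_eq sum_subtractf)
      \<comment> \<open>A single point already pays for \<open>\<tau> i\<close>; hence the separate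
        treatment of empty \<open>P\<close>.\<close>
      moreover have "1 * \<tau> i \<le> card P * \<tau> i"
        using False P(1) by (intro mult_right_mono) (auto simp: \<tau>_def Suc_le_eq card_gt_0_iff)
      moreover have "0 \<le> \<tau> i" by (simp add: \<tau>_def)
      ultimately show ?thesis
        unfolding sum_P using zs(2) by simp
    qed
  qed
qed

section \<open>Assembly of the extension\<close>

text \<open>\<open>R i\<close> after \<open>proj\<close> contributes \<open>N\<close> to the norm,
  and so does the jump series, since a jump is at most twice the norm and the coefficients sum to at
  most \<open>N / 2\<close>. Nullity is checked on simple functions and extended by density.\<close>

lemma exists_extension:
  fixes T :: "('l \<Rightarrow>\<^sub>C real) \<Rightarrow> 'i \<Rightarrow> real" and S :: "('k \<Rightarrow>\<^sub>C real) \<Rightarrow> 'i \<Rightarrow> real"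
  assumes T: "bdd_lin_c0 T" and S: "bdd_lin_c0 S" and S_ext: "\<And>g. S (comp_op \<phi> g) = T g"
  obtains S' :: "('k \<Rightarrow>\<^sub>C real) \<Rightarrow> 'i \<Rightarrow> real"
  where "bdd_lin_c0 S'" "\<And>g. S' (comp_op \<phi> g) = T g" "opnorm_c0 S' \<le> 2 * opnorm_c0 T"
proof -
  define N where "N = opnorm_c0 T"
  have N: "0 \<le> N" unfolding N_def by (rule opnorm_c0_nonneg[OF T])
  \<comment> \<open>\<open>comp_op \<phi>\<close> is isometric, so the bound on \<open>T\<close> is
    the one required on its range.\<close>
  have "\<exists>F. linear F \<and> (\<forall>u. \<bar>F u\<bar> \<le> N * norm u) \<and> (\<forall>g. F (comp_op \<phi> g) = T g i)" for i
    using Hahn_Banach_norm[OF bdd_lin_c0_linear[OF T, of i] comp_op_linear N]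
      opnorm_c0_bound[OF T, of _ i] by (metis N_def norm_comp_op)
  then obtain R where R: "\<And>i. linear (R i)" "\<And>i u. \<bar>R i u\<bar> \<le> N * norm u"
    and R_ext: "\<And>i g. R i (comp_op \<phi> g) = T g i"
    by metis
  obtain M where M: "0 \<le> M" "\<And>h i. \<bar>S h i\<bar> \<le> M * norm h"
    using bdd_lin_c0_uniform_bound[OF S] by metis
  \<comment> \<open>\<open>S\<close> and \<open>R i\<close> both extend \<open>T\<close>, so their
    difference kills the functions pulled back from L.\<close>
  have sum_le: "(\<Sum>t\<in>F. \<bar>S (cut t) i - R i (cut t)\<bar>) \<le> M + N" if "finite F" "F \<subseteq> jumps" for i F
  proof (rule sum_abs_cut_le[where G = "\<lambda>u. S u i - R i u"])
    show "linear (\<lambda>u. S u i - R i u)"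
      by (intro linear_compose_sub bdd_lin_c0_linear[OF S] R)
    show "\<bar>S u i - R i u\<bar> \<le> (M + N) * norm u" for u
      using M(2)[of u i] R(2)[of i u] by (simp add: algebra_simps)
    show "S (comp_op \<phi> g) i - R i (comp_op \<phi> g) = 0" for g
      by (simp add: S_ext R_ext)
  qed (use M N that in auto)
  have c0: "T g \<in> c0" "S h \<in> c0" for g h
    using T S by (auto simp: bdd_lin_c0_def)
  obtain d :: "'i \<Rightarrow> 'l \<Rightarrow> real"
    where d: "\<And>i F. finite F \<Longrightarrow> F \<subseteq> jumps \<Longrightarrow> 2 * (\<Sum>t\<in>F. \<bar>d i t\<bar>) \<le> N"
      "\<And>t. t \<in> jumps \<Longrightarrow> (\<lambda>i. R i (cut t) + d i t) \<in> c0"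
    using exists_jump_coefficients[OF R N R_ext c0 sum_le] by metis
  have sum_jump: "(\<Sum>t\<in>F. \<bar>d i t * jump h t\<bar>) \<le> N * B"
    if F: "finite F" "F \<subseteq> jumps" and h: "\<And>x. x \<in> range lo \<union> range hi \<Longrightarrow> \<bar>apply_bcontfun h x\<bar> \<le> B" for i F h B
  proof -
    have "\<bar>jump h t\<bar> \<le> 2 * B" for t
      using h[of "lo t"] h[of "hi t"] by (simp add: jump_def)
    then have "(\<Sum>t\<in>F. \<bar>d i t * jump h t\<bar>) \<le> (\<Sum>t\<in>F. \<bar>d i t\<bar> * (2 * B))"
      unfolding abs_mult by (intro sum_mono mult_left_mono) auto
    also have "\<dots> = (2 * (\<Sum>t\<in>F. \<bar>d i t\<bar>)) * B"
      by (simp add: sum_distrib_right sum_distrib_left algebra_simps)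
    also have "\<dots> \<le> N * B"
      using d(1)[OF F] h[of "lo undefined"] by (intro mult_right_mono) auto
    finally show ?thesis .
  qed
  have summable: "(\<lambda>t. norm (d i t * jump h t)) summable_on jumps" for i h
    unfolding Infinite_Sum.abs_summable_iff_bdd_above
    using sum_jump[of _ h "norm h" i] abs_apply_le_norm[of h]
    by (auto intro!: bdd_aboveI2[of _ _ "N * norm h"])
  then have summable': "(\<lambda>t. d i t * jump h t) summable_on jumps" for i h
    by (rule Infinite_Sum.abs_summable_summable)
  define S' where "S' h i = R i (proj h) + (\<Sum>\<^sub>\<infinity>t\<in>jumps. d i t * jump h t)" for h i
  have lin: "linear (\<lambda>h. S' h i)" for i
  proof (rule linearI)
    fix h h' :: "'k \<Rightarrow>\<^sub>C real" and c :: real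
    have "(\<Sum>\<^sub>\<infinity>t\<in>jumps. d i t * jump h t + d i t * jump h' t)
        = (\<Sum>\<^sub>\<infinity>t\<in>jumps. d i t * jump h t) + (\<Sum>\<^sub>\<infinity>t\<in>jumps. d i t * jump h' t)"
      by (rule infsum_add[OF summable' summable'])
    then show "S' (h + h') i = S' h i + S' h' i"
      by (simp add: S'_def linear_add[OF proj_linear] linear_add[OF R(1)] distrib_left)
    have "(\<Sum>\<^sub>\<infinity>t\<in>jumps. c * (d i t * jump h t)) = c * (\<Sum>\<^sub>\<infinity>t\<in>jumps. d i t * jump h t)"
      by (rule infsum_cmult_right')
    then show "S' (c *\<^sub>R h) i = c *\<^sub>R S' h i"
      by (simp add: S'_def linear_scale[OF proj_linear] linear_scale[OF R(1)] algebra_simps)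
  qed
  \<comment> \<open>The bound involves endpoints only, because simple functions approximate
    \<open>h\<close> only there.\<close>
  have bound: "\<bar>S' h i\<bar> \<le> 2 * N * B"
    if h: "\<And>x. x \<in> range lo \<union> range hi \<Longrightarrow> \<bar>apply_bcontfun h x\<bar> \<le> B" for h B i
  proof -
    have "\<bar>R i (proj h)\<bar> \<le> N * norm (proj h)"
      by (rule R(2))
    also have "\<dots> \<le> N * B"
      using h N by (intro mult_left_mono norm_proj_le)
    finally have "\<bar>R i (proj h)\<bar> \<le> N * B" .
    moreover have "norm (\<Sum>\<^sub>\<infinity>t\<in>jumps. d i t * jump h t) \<le> (\<Sum>\<^sub>\<infinity>t\<in>jumps. norm (d i t * jump h t))"
      by (rule norm_infsum_bound[OF summable])
    moreover have "(\<Sum>\<^sub>\<infinity>t\<in>jumps. norm (d i t * jump h t)) \<le> N * B"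
      using sum_jump h by (intro infsum_le_finite_sums summable) auto
    ultimately show ?thesis
      unfolding S'_def by simp
  qed
  have bound_norm: "\<bar>S' h i\<bar> \<le> 2 * N * norm h" for h i
    using abs_apply_le_norm by (rule bound)
  have ext: "S' (comp_op \<phi> g) = T g" for g
    by (rule ext) (simp add: S'_def proj_comp_op R_ext)
  have on_simple: "S' (simple g F r) i = T g i + (\<Sum>t\<in>F. r t * (R i (cut t) + d i t))"
    if F: "finite F" "F \<subseteq> jumps" for g F r i
  proof -
    have jump_simple: "jump (simple g F r) s = (if s \<in> F then r s else 0)" for s
    proof -
      have "jump (simple g F r) s = (\<Sum>t\<in>F. r t * jump (cut t) s)"
        by (simp add: simple_def)
      also have "\<dots> = (\<Sum>t\<in>F. r t * of_bool (s = t))"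
        using F by (intro sum.cong) (auto simp: jump_cut)
      finally show ?thesis
        using F(1) by (simp add: of_bool_def if_distrib sum.delta cong: if_cong)
    qed
    have "(\<Sum>\<^sub>\<infinity>t\<in>jumps. d i t * jump (simple g F r) t) = (\<Sum>\<^sub>\<infinity>t\<in>F. d i t * r t)"
      using F by (intro infsum_cong_neutral) (auto simp: jump_simple)
    also have "\<dots> = (\<Sum>t\<in>F. d i t * r t)"
      using F(1) by simp
    finally show ?thesis
      using F by (simp add: S'_def proj_simple)
        (simp add: simple_def linear_add[OF R(1)] linear_sum[OF R(1)] linear_scale[OF R(1)] R_ext
          sum.distrib algebra_simps)
  qed
  have "S' h \<in> c0" for h
  proof (rule c0_approx)
    fix e :: real assume e: "0 < e"
    \<comment> \<open>The summand 1 covers the case \<open>N = 0\<close>.\<close>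
    define \<epsilon> where "\<epsilon> = e / (2 * N + 1)"
    have \<epsilon>: "0 < \<epsilon>" "2 * N * \<epsilon> \<le> e"
      using e N by (auto simp: \<epsilon>_def field_simps)
    obtain g F r where F: "finite F" "F \<subseteq> jumps"
      and near: "\<And>x. x \<in> range lo \<union> range hi \<Longrightarrow> \<bar>apply_bcontfun h x - simple g F r x\<bar> < \<epsilon>"
      using simple_dense[OF \<epsilon>(1), of h] by metis
    have "S' (simple g F r) \<in> c0"
    proof -
      have "(\<lambda>i. r t * (R i (cut t) + d i t)) \<in> c0" if "t \<in> F" for t
        using that F by (intro c0_cmult d(2)) auto
      then have "(\<lambda>i. T g i + (\<Sum>t\<in>F. r t * (R i (cut t) + d i t))) \<in> c0"
        using c0(1) by (intro c0_add c0_sum)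
      then show ?thesis
        by (simp only: on_simple[OF F, symmetric])
    qed
    moreover have "\<bar>S' h i\<bar> \<le> \<bar>S' (simple g F r) i\<bar> + e" for i
    proof -
      have "\<bar>S' (h - simple g F r) i\<bar> \<le> 2 * N * \<epsilon>"
        using near by (intro bound) (simp add: less_imp_le)
      then show ?thesis
        using \<epsilon>(2) linear_diff[OF lin, of h "simple g F r" i] by linarith
    qed
    ultimately show "\<exists>b\<in>c0. \<forall>i. \<bar>S' h i\<bar> \<le> \<bar>b i\<bar> + e"
      by blast
  qed
  then have "bdd_lin_c0 S'"
    using bdd_lin_c0I[of S' "2 * N"] lin bound_norm by blast
  moreover have "opnorm_c0 S' \<le> 2 * N"
    using bound_norm N by (intro opnorm_c0_le) auto
  ultimately show thesis
    using ext that unfolding N_def by blast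
qed

end

theorem theorem2p26:
  fixes \<phi> :: "'k::linorder_topology \<Rightarrow> 'l::linorder_topology"
    and T :: "('l \<Rightarrow>\<^sub>C real) \<Rightarrow> ('i \<Rightarrow> real)"
  assumes "compact (UNIV :: 'k set)" and "compact (UNIV :: 'l set)"
    and "continuous_on UNIV \<phi>" and "mono \<phi>" and "surj \<phi>"
    and "bdd_lin_c0 T"
    and "\<exists>S :: ('k \<Rightarrow>\<^sub>C real) \<Rightarrow> ('i \<Rightarrow> real). bdd_lin_c0 S \<and> (\<forall>g. S (comp_op \<phi> g) = T g)"
  shows "\<exists>S' :: ('k \<Rightarrow>\<^sub>C real) \<Rightarrow> ('i \<Rightarrow> real). bdd_lin_c0 S' \<and> (\<forall>g. S' (comp_op \<phi> g) = T g)
           \<and> opnorm_c0 S' \<le> 2 * opnorm_c0 T"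
proof -
  interpret compact_line_surjection \<phi>
    using assms(1-5) by unfold_locales
  obtain S :: "('k \<Rightarrow>\<^sub>C real) \<Rightarrow> 'i \<Rightarrow> real" where "bdd_lin_c0 S" "\<And>g. S (comp_op \<phi> g) = T g"
    using assms(7) by blast
  from exists_extension[OF assms(6) this] show ?thesis
    by metis
qed

end
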